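(* For $0\le x<1$, $\Phi^G(x)=0.5$; $\Phi^G(1)=0.75$; and for $x\ge\sqrt{3}$, $\Phi^G(x)=\Phi(x)$, where $\Phi$ is the standard normal cumulative distribution function (in particular $\Phi^G(\sqrt{3})=\Phi(\sqrt{3})$, which equals $0.958$ to three decimals).
   Context: Let $Z_1,Z_2,\ldots$ be independent standard normal random variables. For integers $n\ge2$ and $a\ge 0$ the quantity $t_{n-1}^G(a)$ is defined by $$1-t_{n-1}^G(a):=\frac12\sup P\left\{\frac{\left(\sum_{i=1}^n\sigma_iZ_i\right)^2}{\sum_{i=1}^n\sigma_i^2Z_i^2}>a^2\right\},$$ where the supremum is over all non-random numbers $\sigma_1,\ldots,\sigma_n\ge 0$ with $\sigma_i>0$ for at least one $i$. For $x\ge0$, $\Phi^G(x):=\lim_{n\to\infty}t_n^G(x)$. *)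

theory Defs
  imports "HOL-Probability.Probability"
begin

definition self_norm_sq :: "nat \<Rightarrow> (nat \<Rightarrow> real) \<Rightarrow> (nat \<Rightarrow> real) \<Rightarrow> real" where
  "self_norm_sq n \<sigma> z =
     (\<Sum>i=1..n. \<sigma> i * z i)\<^sup>2 / (\<Sum>i=1..n. (\<sigma> i)\<^sup>2 * (z i)\<^sup>2)"

(* Only the values of a scale sequence on {1..n} matter. *)
definition admissible_scales :: "nat \<Rightarrow> (nat \<Rightarrow> real) set" where
  "admissible_scales n =
     {\<sigma>. (\<forall>i\<in>{1..n}. \<sigma> i \<ge> 0) \<and> (\<exists>i\<in>{1..n}. \<sigma> i > 0)}"

(* The index m counts degrees of freedom: t_{n-1} is built from n variables.
   The supremum is over a nonempty set of probabilities, so the conditionally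
   complete real Sup is the intended one. *)
definition tG :: "'a measure \<Rightarrow> (nat \<Rightarrow> 'a \<Rightarrow> real) \<Rightarrow> nat \<Rightarrow> real \<Rightarrow> real" where
  "tG M Z m a =
     1 - 1/2 * (SUP \<sigma>\<in>admissible_scales (m + 1).
       measure M {\<omega> \<in> space M. self_norm_sq (m + 1) \<sigma> (\<lambda>i. Z i \<omega>) > a\<^sup>2})"

(* The limit is meaningful only together with convergence of the sequence. *)
definition PhiG :: "'a measure \<Rightarrow> (nat \<Rightarrow> 'a \<Rightarrow> real) \<Rightarrow> real \<Rightarrow> real" where
  "PhiG M Z x = lim (\<lambda>n. tG M Z n x)"

abbreviation std_normal_cdf :: "real \<Rightarrow> real" where
  "std_normal_cdf \<equiv> cdf std_normal_distribution"

end

theory Submission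
  imports Defs "HOL-Real_Asymp.Real_Asymp"
begin

text \<open>Write \<open>A = x\<^sup>2\<close>, \<open>S = \<Sum>i. \<sigma> i * Z i\<close> and \<open>V\<close> for \<open>\<Sum>i. (\<sigma> i)\<^sup>2 * (Z i)\<^sup>2\<close>. The quantity to be maximised over the scales is
the probability that the quadratic form \<open>S\<^sup>2 - A * V\<close> is positive. It is computed exactly, and the exact
formula is then compared with that for a normal variable.

The formula. The quadratic form has at most one positive eigenvalue. After a normalisation this eigenvalue is 1, and the
event reads \<open>q < Y\<^sup>2\<close> with \<open>Y\<close> standard normal and independent of the nonnegative form \<open>q\<close>. Craig's formula
(\<open>craig_formula\<close>) writes the probability as an integral of Laplace transforms of \<open>q\<close>, and these are explicit. In terms of the
weights \<open>b i = A * (\<sigma> i)\<^sup>2 / (1 + A * (\<sigma> i)\<^sup>2)\<close>, which have sum \<open>A\<close>, the result (\<open>cone_probability\<close>) is the integral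
of \<open>2 / pi / ((1 + v\<^sup>2) * sqrt (G (v\<^sup>2)))\<close> over \<open>v \<ge> 0\<close>, where \<open>G u\<close> is
\<open>(\<Prod>i. (1 + u * b i) / (1 - b i)) * (\<Sum>i. b i * (1 - b i) / (1 + u * b i)) / A\<close>. Independence is used in the form of
an identity for resampling one component (\<open>gauss_prod_resample\<close>), which replaces both the diagonalisation
of the form and the computation of a determinant.

Level \<open>A \<ge> 3\<close>. If all weights are infinitesimal, then \<open>G u = exp ((1 + u) * A)\<close> and the probability is the two-sided normal tail.
Breaking the largest weights into infinitesimal ones does not decrease the integral: the derivative of the
integrand is bounded by a total derivative in \<open>v\<close>, and the bound holds because \<open>(A - 3) * (A - \<tau>)\<close> is nonnegative,
\<open>\<tau> < 1\<close> being the largest weight (\<open>dL_\<tau>_lower\<close>, \<open>capped_integral_le\<close>). So the normal tail is an upper bound for every choice of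
the scales, and equal scales approach it (\<open>cone_probability_all_equal\<close>).

Level \<open>A = 1\<close>. Here \<open>2 + u \<le> G u\<close>, with equality for two equal scales (\<open>unit_weights_bound\<close>), so the
maximal probability is \<open>1 / 2\<close>. For \<open>x < 1\<close> a single nonzero scale makes the event almost sure. The limit over the number of
variables exists for every \<open>x\<close>, since further variables can be given scale zero.\<close>

section \<open>Shifting Gaussian product measures\<close>

abbreviation gauss_prod :: "'i set \<Rightarrow> ('i \<Rightarrow> real) measure" where
  "gauss_prod I \<equiv> PiM I (\<lambda>_. std_normal_distribution)"

lemma product_prob_space_gauss: "product_prob_space (\<lambda>_. std_normal_distribution)"
  by (intro product_prob_spaceI prob_space_normal_density) simp

text \<open>Both measures agree on boxes, where the integral of a product of one-variable functions factorises.\<close>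
lemma density_PiM:
  assumes "finite I" "product_sigma_finite M" "product_sigma_finite (\<lambda>i. density (M i) (f i))"
    and [measurable]: "\<And>i. i \<in> I \<Longrightarrow> f i \<in> borel_measurable (M i)"
  shows "density (PiM I M) (\<lambda>x. \<Prod>i\<in>I. f i (x i)) = PiM I (\<lambda>i. density (M i) (f i))"
proof (rule product_sigma_finite.PiM_eqI[OF assms(3,1)])
  show "sets (density (PiM I M) (\<lambda>x. \<Prod>i\<in>I. f i (x i))) = sets (PiM I (\<lambda>i. density (M i) (f i)))"
    by (simp cong: sets_PiM_cong)
next
  fix A assume "\<And>i. i \<in> I \<Longrightarrow> A i \<in> sets (density (M i) (f i))"
  then have A[measurable]: "\<And>i. i \<in> I \<Longrightarrow> A i \<in> sets (M i)" by simp
  have "emeasure (density (PiM I M) (\<lambda>x. \<Prod>i\<in>I. f i (x i))) (Pi\<^sub>E I A)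
      = (\<integral>\<^sup>+x. (\<Prod>i\<in>I. f i (x i)) * indicator (Pi\<^sub>E I A) x \<partial>PiM I M)"
    using assms(1) by (intro emeasure_density) (auto intro!: sets_PiM_I_finite)
  also have "\<dots> = (\<integral>\<^sup>+x. (\<Prod>i\<in>I. f i (x i) * indicator (A i) (x i)) \<partial>PiM I M)"
  proof (rule nn_integral_cong)
    fix x assume "x \<in> space (PiM I M)"
    then have "indicator (Pi\<^sub>E I A) x = (\<Prod>i\<in>I. indicator (A i) (x i) :: ennreal)"
      using assms(1) by (auto simp: indicator_def space_PiM PiE_iff)
    then show "(\<Prod>i\<in>I. f i (x i)) * indicator (Pi\<^sub>E I A) x = (\<Prod>i\<in>I. f i (x i) * indicator (A i) (x i))"
      by (simp add: prod.distrib)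
  qed
  also have "\<dots> = (\<Prod>i\<in>I. \<integral>\<^sup>+y. f i y * indicator (A i) y \<partial>M i)"
    by (intro product_sigma_finite.product_nn_integral_prod[OF assms(2,1)]) auto
  also have "\<dots> = (\<Prod>i\<in>I. emeasure (density (M i) (f i)) (A i))"
    by (intro prod.cong) (auto simp: emeasure_density)
  finally show "emeasure (density (PiM I M) (\<lambda>x. \<Prod>i\<in>I. f i (x i))) (Pi\<^sub>E I A)
      = (\<Prod>i\<in>I. emeasure (density (M i) (f i)) (A i))" .
qed

lemma distr_PiM_componentwise:
  assumes I: "finite I" and M: "\<And>i. prob_space (M i)"
    and [measurable]: "\<And>i. g i \<in> M i \<rightarrow>\<^sub>M N i"
  shows "distr (PiM I M) (PiM I N) (\<lambda>z. \<lambda>i\<in>I. g i (z i)) = PiM I (\<lambda>i. distr (M i) (N i) (g i))"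
proof -
  interpret M: product_prob_space M by (intro product_prob_spaceI M)
  interpret D: product_prob_space "\<lambda>i. distr (M i) (N i) (g i)"
    by (intro product_prob_spaceI prob_space.prob_space_distr M assms(3))
  show ?thesis
  proof (rule D.PiM_eqI[OF I])
    show "sets (distr (PiM I M) (PiM I N) (\<lambda>z. \<lambda>i\<in>I. g i (z i))) = sets (PiM I (\<lambda>i. distr (M i) (N i) (g i)))"
      by (simp cong: sets_PiM_cong)
  next
    fix A assume "\<And>i. i \<in> I \<Longrightarrow> A i \<in> sets (distr (M i) (N i) (g i))"
    then have A[measurable]: "\<And>i. i \<in> I \<Longrightarrow> A i \<in> sets (N i)" by simp
    have "emeasure (distr (PiM I M) (PiM I N) (\<lambda>z. \<lambda>i\<in>I. g i (z i))) (Pi\<^sub>E I A)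
      = emeasure (PiM I M) ((\<lambda>z. \<lambda>i\<in>I. g i (z i)) -` Pi\<^sub>E I A \<inter> space (PiM I M))"
      using I by (intro emeasure_distr) (auto intro!: sets_PiM_I_finite)
    also have "(\<lambda>z. \<lambda>i\<in>I. g i (z i)) -` Pi\<^sub>E I A \<inter> space (PiM I M) = (\<Pi>\<^sub>E i\<in>I. g i -` A i \<inter> space (M i))"
      by (auto simp: space_PiM PiE_iff)
    also have "emeasure (PiM I M) \<dots> = (\<Prod>i\<in>I. emeasure (M i) (g i -` A i \<inter> space (M i)))"
      by (intro M.emeasure_PiM I) auto
    also have "\<dots> = (\<Prod>i\<in>I. emeasure (distr (M i) (N i) (g i)) (A i))"
      by (intro prod.cong) (auto simp: emeasure_distr)
    finally show "emeasure (distr (PiM I M) (PiM I N) (\<lambda>z. \<lambda>i\<in>I. g i (z i))) (Pi\<^sub>E I A)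
      = (\<Prod>i\<in>I. emeasure (distr (M i) (N i) (g i)) (A i))" .
  qed
qed

lemma normal_density_shift:
  "normal_density a 1 x = std_normal_density x * exp (a * x - a\<^sup>2 / 2)"
  unfolding normal_density_def
  by (simp add: exp_add[symmetric] power2_eq_square field_simps)

lemma distr_std_normal_shift:
  "distr std_normal_distribution borel (\<lambda>z. z + a) = density std_normal_distribution (\<lambda>z. exp (a * z - a\<^sup>2 / 2))"
proof -
  interpret prob_space std_normal_distribution by (rule prob_space_normal_density) simp
  have "distributed std_normal_distribution lborel (\<lambda>x. x) std_normal_density"
    unfolding distributed_def by (simp add: distr_id2 distr_id[unfolded id_def])
  from normal_density_affine[OF this _ , of 1 a]
  have "distributed std_normal_distribution lborel (\<lambda>x. a + x) (normal_density a 1)" by simp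
  then have "distr std_normal_distribution lborel (\<lambda>x. a + x) = density lborel (normal_density a 1)"
    by (simp add: distributed_def)
  also have "(\<lambda>x. ennreal (normal_density a 1 x)) = (\<lambda>x. ennreal (std_normal_density x) * ennreal (exp (a * x - a\<^sup>2 / 2)))"
    by (subst normal_density_shift) (simp add: ennreal_mult')
  also have "density lborel \<dots> = density std_normal_distribution (\<lambda>z. exp (a * z - a\<^sup>2 / 2))"
    by (subst density_density_eq) auto
  finally have "distr std_normal_distribution lborel (\<lambda>x. a + x) = density std_normal_distribution (\<lambda>z. exp (a * z - a\<^sup>2 / 2))" .
  also have "distr std_normal_distribution lborel (\<lambda>x. a + x) = distr std_normal_distribution borel (\<lambda>z. z + a)"
    by (intro distr_cong) (auto simp: add.commute)
  finally show ?thesis .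
qed

text \<open>The Cameron-Martin formula in finite dimension: the coordinates are shifted one by one, and a shifted
standard normal variable has the exponential density of \<open>distr_std_normal_shift\<close> with respect to the unshifted one.\<close>
lemma gauss_prod_shift:
  assumes I: "finite I" and f[measurable]: "f \<in> borel_measurable (PiM I (\<lambda>_. borel))"
  shows "(\<integral>\<^sup>+z. f (\<lambda>i\<in>I. z i + s * e i) \<partial>gauss_prod I)
    = (\<integral>\<^sup>+z. ennreal (exp (s * (\<Sum>i\<in>I. e i * z i) - s\<^sup>2 * (\<Sum>i\<in>I. (e i)\<^sup>2) / 2)) * f z \<partial>gauss_prod I)"
proof -
  have sh: "prob_space (distr std_normal_distribution borel (\<lambda>z. z + a))" for a :: real
    by (intro prob_space.prob_space_distr prob_space_normal_density) auto
  have psf1: "product_sigma_finite (\<lambda>_::'a. std_normal_distribution)"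
    using product_prob_space_gauss by (auto intro: product_prob_space.axioms(1))
  have psf2: "product_sigma_finite (\<lambda>i. density std_normal_distribution (\<lambda>z. exp (s * e i * z - (s * e i)\<^sup>2 / 2)))"
    unfolding distr_std_normal_shift[symmetric]
    using product_prob_spaceI[of "\<lambda>i. distr std_normal_distribution borel (\<lambda>z. z + s * e i)", OF sh]
    by (auto intro: product_prob_space.axioms(1))
  have sets[measurable_cong]: "sets (gauss_prod I) = sets (PiM I (\<lambda>_. borel))" by (intro sets_PiM_cong) auto
  have "distr (gauss_prod I) (PiM I (\<lambda>_. borel)) (\<lambda>z. \<lambda>i\<in>I. z i + s * e i)
     = PiM I (\<lambda>i. distr std_normal_distribution borel (\<lambda>z. z + s * e i))"
    by (intro distr_PiM_componentwise I prob_space_normal_density) auto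
  also have "\<dots> = density (gauss_prod I) (\<lambda>z. \<Prod>i\<in>I. ennreal (exp (s * e i * z i - (s * e i)\<^sup>2 / 2)))"
    unfolding distr_std_normal_shift by (subst density_PiM[OF I psf1 psf2]) auto
  also have "\<dots> = density (gauss_prod I) (\<lambda>z. ennreal (exp (s * (\<Sum>i\<in>I. e i * z i) - s\<^sup>2 * (\<Sum>i\<in>I. (e i)\<^sup>2) / 2)))"
    by (simp add: prod_ennreal exp_sum[OF I, symmetric] sum_subtractf sum_distrib_left sum_divide_distrib
        power_mult_distrib mult.assoc)
  finally have *: "distr (gauss_prod I) (PiM I (\<lambda>_. borel)) (\<lambda>z. \<lambda>i\<in>I. z i + s * e i) = \<dots>" .
  have "(\<integral>\<^sup>+z. f (\<lambda>i\<in>I. z i + s * e i) \<partial>gauss_prod I)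
     = (\<integral>\<^sup>+z. f z \<partial>distr (gauss_prod I) (PiM I (\<lambda>_. borel)) (\<lambda>z. \<lambda>i\<in>I. z i + s * e i))"
    by (subst nn_integral_distr) measurable
  then show ?thesis unfolding * by (simp add: nn_integral_density)
qed

section \<open>Resampling the component along a direction\<close>

lemma sets_gauss_prod[measurable_cong]: "sets (gauss_prod I) = sets (PiM I (\<lambda>_. borel))"
  by (intro sets_PiM_cong) auto

lemma prob_space_gauss_prod: "prob_space (gauss_prod I)"
  by (intro prob_space_PiM prob_space_normal_density) simp

text \<open>Under \<open>gauss_prod I\<close> the component \<open>Y\<close> of \<open>z\<close> along a unit vector \<open>e\<close> is standard normal and independent
of the rest. Integrating \<open>f\<close> therefore does not change if this component is replaced by a new variable
\<open>Y z + s\<close> with standard normal density. No orthogonal change of coordinates is used: after the order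
of integration is exchanged, the Cameron-Martin formula moves the shift into a density, and the remaining
integral over \<open>s\<close> is that of the normal density with mean \<open>Y z\<close>, which is 1.\<close>
lemma gauss_prod_resample:
  assumes I: "finite I" and e: "(\<Sum>i\<in>I. (e i)\<^sup>2) = 1"
    and f[measurable]: "f \<in> borel_measurable (PiM I (\<lambda>_. borel))"
  shows "(\<integral>\<^sup>+z. f z \<partial>gauss_prod I) =
    (\<integral>\<^sup>+z. (\<integral>\<^sup>+s. ennreal (std_normal_density ((\<Sum>i\<in>I. e i * z i) + s)) * f (\<lambda>i\<in>I. z i + s * e i) \<partial>lborel) \<partial>gauss_prod I)"
proof -
  interpret G: prob_space "gauss_prod I" by (rule prob_space_gauss_prod)
  interpret P: pair_sigma_finite "gauss_prod I" lborel ..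
  define Y where "Y z = (\<Sum>i\<in>I. e i * z i)" for z
  have [measurable]: "Y \<in> borel_measurable (PiM I (\<lambda>_. borel))" unfolding Y_def by measurable
  have Y_shift: "Y (\<lambda>i\<in>I. z i + s * e i) = Y z + s" for z s
    using e unfolding Y_def
    by (simp add: algebra_simps sum.distrib power2_eq_square flip: sum_distrib_left)
  have "(\<integral>\<^sup>+z. (\<integral>\<^sup>+s. ennreal (std_normal_density (Y z + s)) * f (\<lambda>i\<in>I. z i + s * e i) \<partial>lborel) \<partial>gauss_prod I)
      = (\<integral>\<^sup>+s. (\<integral>\<^sup>+z. ennreal (std_normal_density (Y z + s)) * f (\<lambda>i\<in>I. z i + s * e i) \<partial>gauss_prod I) \<partial>lborel)"
    by (rule P.Fubini'[symmetric]) measurable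
  also have "\<dots> = (\<integral>\<^sup>+s. (\<integral>\<^sup>+z. ennreal (exp (s * Y z - s\<^sup>2 / 2)) * (ennreal (std_normal_density (Y z)) * f z) \<partial>gauss_prod I) \<partial>lborel)"
    using gauss_prod_shift[OF I, of "\<lambda>z. ennreal (std_normal_density (Y z)) * f z" _ e]
    unfolding Y_shift e by (simp add: Y_def)
  also have "\<dots> = (\<integral>\<^sup>+s. (\<integral>\<^sup>+z. ennreal (normal_density (Y z) 1 s) * f z \<partial>gauss_prod I) \<partial>lborel)"
  proof (intro nn_integral_cong)
    fix s z
    have "normal_density (Y z) 1 s = exp (s * Y z - s\<^sup>2 / 2) * std_normal_density (Y z)"
      using normal_density_shift[of s "Y z"]
      by (simp add: normal_density_def power2_commute mult.commute)
    then show "ennreal (exp (s * Y z - s\<^sup>2 / 2)) * (ennreal (std_normal_density (Y z)) * f z)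
        = ennreal (normal_density (Y z) 1 s) * f z"
      by (simp add: ennreal_mult' mult.assoc)
  qed
  also have "\<dots> = (\<integral>\<^sup>+z. (\<integral>\<^sup>+s. ennreal (normal_density (Y z) 1 s) * f z \<partial>lborel) \<partial>gauss_prod I)"
    by (rule P.Fubini') (simp add: normal_density_def, measurable)
  also have "\<dots> = (\<integral>\<^sup>+z. f z \<partial>gauss_prod I)"
    by (intro nn_integral_cong)
       (simp add: nn_integral_multc nn_integral_eq_integral normal_density_nonneg)
  finally show ?thesis by (simp add: Y_def)
qed

section \<open>The Gaussian tail as a mixture of exponentials\<close>

lemma half_line_gauss_integral:
  assumes "y > 0"
  shows "(\<integral>\<^sup>+v. ennreal (exp (- (y\<^sup>2 * v\<^sup>2 / 2))) * indicator {0..} v \<partial>lborel) = ennreal (sqrt (pi / 2) / y)"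
proof -
  have "(\<integral>\<^sup>+x. ennreal (exp (- x\<^sup>2)) * indicator {0..} x \<partial>lborel) = ennreal (sqrt pi / 2)"
  proof -
    have "(\<integral>\<^sup>+x. ennreal (indicator {0..} x *\<^sub>R exp (- x\<^sup>2)) \<partial>lborel) = ennreal (sqrt pi / 2)"
      using gaussian_moment_0
      by (subst nn_integral_eq_integral)
         (auto simp: has_bochner_integral_iff)
    then show ?thesis
      by (simp add: ennreal_mult' ennreal_indicator mult.commute)
  qed
  also have "(\<integral>\<^sup>+x. ennreal (exp (- x\<^sup>2)) * indicator {0..} x \<partial>lborel)
     = ennreal (y / sqrt 2) * (\<integral>\<^sup>+v. ennreal (exp (- (y / sqrt 2 * v)\<^sup>2)) * indicator {0..} (y / sqrt 2 * v) \<partial>lborel)"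
    using assms by (subst nn_integral_real_affine[where c = "y / sqrt 2" and t = 0]) auto
  also have "(\<integral>\<^sup>+v. ennreal (exp (- (y / sqrt 2 * v)\<^sup>2)) * indicator {0..} (y / sqrt 2 * v) \<partial>lborel)
    = (\<integral>\<^sup>+v. ennreal (exp (- (y\<^sup>2 * v\<^sup>2 / 2))) * indicator {0..} v \<partial>lborel)"
    using assms by (intro nn_integral_cong) (auto simp: indicator_def power_mult_distrib power_divide zero_le_mult_iff zero_le_divide_iff)
  finally have "ennreal (sqrt 2 / y) * ennreal (sqrt pi / 2) = ennreal (sqrt 2 / y) * (ennreal (y / sqrt 2) * (\<integral>\<^sup>+v. ennreal (exp (- (y\<^sup>2 * v\<^sup>2 / 2))) * indicator {0..} v \<partial>lborel))"
    by simp
  also have "\<dots> = (\<integral>\<^sup>+v. ennreal (exp (- (y\<^sup>2 * v\<^sup>2 / 2))) * indicator {0..} v \<partial>lborel)"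
    using assms by (simp add: mult.assoc[symmetric] ennreal_mult'[symmetric])
  also have "ennreal (sqrt 2 / y) * ennreal (sqrt pi / 2) = ennreal (sqrt (pi / 2) / y)"
    using assms by (subst ennreal_mult'[symmetric]) (auto simp: real_sqrt_divide field_simps)
  finally show ?thesis by simp
qed

lemma std_normal_two_sided:
  assumes "q \<ge> 0"
  shows "emeasure std_normal_distribution {y. q < y\<^sup>2} = 2 * emeasure std_normal_distribution {sqrt q<..}"
proof -
  have set: "{y. q < y\<^sup>2} = {sqrt q<..} \<union> {..<- sqrt q}"
  proof (rule set_eqI)
    fix y :: real
    have "q < y\<^sup>2 \<longleftrightarrow> sqrt q < \<bar>y\<bar>"
      using real_sqrt_less_iff[of q "y\<^sup>2"] by simp
    then show "y \<in> {y. q < y\<^sup>2} \<longleftrightarrow> y \<in> {sqrt q<..} \<union> {..<- sqrt q}"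
      unfolding mem_Collect_eq by (simp only: Un_iff greaterThan_iff lessThan_iff) linarith
  qed
  have "emeasure std_normal_distribution {..<- sqrt q}
      = (\<integral>\<^sup>+y. ennreal (std_normal_density y) * indicator {..<- sqrt q} y \<partial>lborel)"
    by (simp add: emeasure_density)
  also have "\<dots> = (\<integral>\<^sup>+y. ennreal (std_normal_density (- y)) * indicator {..<- sqrt q} (- y) \<partial>lborel)"
    by (subst nn_integral_real_affine[where c = "-1" and t = 0]) auto
  also have "\<dots> = (\<integral>\<^sup>+y. ennreal (std_normal_density y) * indicator {sqrt q<..} y \<partial>lborel)"
    by (intro nn_integral_cong) (simp add: normal_density_def indicator_def)
  also have "\<dots> = emeasure std_normal_distribution {sqrt q<..}"
    by (simp add: emeasure_density)
  finally have "emeasure std_normal_distribution {..<- sqrt q} = emeasure std_normal_distribution {sqrt q<..}" .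
  moreover have "{sqrt q<..} \<inter> {..<- sqrt q} = {}"
    using real_sqrt_ge_zero[OF assms] by (auto simp del: real_sqrt_ge_0_iff)
  ultimately show ?thesis unfolding set
    by (subst plus_emeasure[symmetric]) (auto simp: mult_2)
qed

text \<open>Craig's formula. Its point is that the dependence on \<open>q\<close> becomes exponential, so that a quadratic form
can be substituted for \<open>q\<close> and averaged under a Gaussian measure. The integrand is itself an integral
over \<open>y \<ge> sqrt q\<close>; exchanging the two integrals leaves a half-line Gaussian integral in \<open>v\<close>, which cancels
the factor \<open>y\<close>.\<close>
lemma craig_formula:
  assumes q: "q \<ge> 0"
  shows "emeasure std_normal_distribution {y. q < y\<^sup>2} =
    (\<integral>\<^sup>+v. ennreal (2 / pi * exp (- (q * (1 + v\<^sup>2) / 2)) / (1 + v\<^sup>2)) * indicator {0..} v \<partial>lborel)"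
proof -
  have inner: "(\<integral>\<^sup>+y. ennreal (y * exp (- (y\<^sup>2 * (1 + v\<^sup>2) / 2))) * indicator {sqrt q..} y \<partial>lborel)
     = ennreal (exp (- (q * (1 + v\<^sup>2) / 2)) / (1 + v\<^sup>2))" for v :: real
  proof -
    define c where "c = 1 + v\<^sup>2"
    have p: "c > 0" by (simp add: c_def add_pos_nonneg)
    have "((\<lambda>y. - exp (- (y\<^sup>2 * c / 2)) / c) \<longlongrightarrow> 0) at_top"
      using p by real_asymp
    moreover have "((\<lambda>y. - exp (- (y\<^sup>2 * c / 2)) / c) has_real_derivative y * exp (- (y\<^sup>2 * c / 2))) (at y)" for y
      using p by (auto intro!: derivative_eq_intros)
    moreover have "0 \<le> y" if "sqrt q \<le> y" for y
      using that real_sqrt_ge_zero[OF q] by linarith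
    ultimately have "(\<integral>\<^sup>+y. ennreal (y * exp (- (y\<^sup>2 * c / 2))) * indicator {sqrt q..} y \<partial>lborel)
      = ennreal (0 - (- exp (- ((sqrt q)\<^sup>2 * c / 2)) / c))"
      by (intro nn_integral_FTC_atLeast) auto
    then show ?thesis using q by (simp add: c_def)
  qed
  have "(\<integral>\<^sup>+v. ennreal (exp (- (q * (1 + v\<^sup>2) / 2)) / (1 + v\<^sup>2)) * indicator {0..} v \<partial>lborel)
    = (\<integral>\<^sup>+v. (\<integral>\<^sup>+y. ennreal (y * exp (- (y\<^sup>2 * (1 + v\<^sup>2) / 2))) * indicator {sqrt q..} y * indicator {0..} v \<partial>lborel) \<partial>lborel)"
    unfolding inner[symmetric] by (subst nn_integral_multc) auto
  also have "\<dots> = (\<integral>\<^sup>+y. (\<integral>\<^sup>+v. ennreal (y * exp (- (y\<^sup>2 * (1 + v\<^sup>2) / 2))) * indicator {sqrt q..} y * indicator {0..} v \<partial>lborel) \<partial>lborel)"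
    by (rule lborel_pair.Fubini') measurable
  also have "\<dots> = (\<integral>\<^sup>+y. ennreal (pi / 2) * (2 * (ennreal (std_normal_density y) * indicator {sqrt q<..} y)) \<partial>lborel)"
  proof (rule nn_integral_cong_AE)
    show "AE y in lborel. (\<integral>\<^sup>+v. ennreal (y * exp (- (y\<^sup>2 * (1 + v\<^sup>2) / 2))) * indicator {sqrt q..} y * indicator {0..} v \<partial>lborel)
       = ennreal (pi / 2) * (2 * (ennreal (std_normal_density y) * indicator {sqrt q<..} y))"
      using AE_lborel_singleton[of "sqrt q"]
    proof eventually_elim
      case (elim y)
      show ?case
      proof (cases "sqrt q < y")
        case True
        then have y: "y > 0" using real_sqrt_ge_zero[OF q] by linarith
        have "(\<integral>\<^sup>+v. ennreal (y * exp (- (y\<^sup>2 * (1 + v\<^sup>2) / 2))) * indicator {sqrt q..} y * indicator {0..} v \<partial>lborel)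
          = (\<integral>\<^sup>+v. ennreal (y * exp (- (y\<^sup>2 / 2))) * (ennreal (exp (- (y\<^sup>2 * v\<^sup>2 / 2))) * indicator {0..} v) \<partial>lborel)"
          using True y
          by (intro nn_integral_cong)
             (auto simp: indicator_def exp_add[symmetric] field_simps simp flip: ennreal_mult')
        also have "\<dots> = ennreal (y * exp (- (y\<^sup>2 / 2))) * ennreal (sqrt (pi / 2) / y)"
          using half_line_gauss_integral[OF y] by (subst nn_integral_cmult) auto
        also have "\<dots> = ennreal (pi / 2 * (2 * std_normal_density y))"
        proof -
          have "sqrt pi * sqrt pi = pi" by simp
          then have "sqrt (pi / 2) = pi / sqrt (2 * pi)"
            by (simp add: real_sqrt_divide real_sqrt_mult field_simps)
          then show ?thesis using y
            by (subst ennreal_mult'[symmetric]) (auto simp: normal_density_def)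
        qed
        also have "\<dots> = ennreal (pi / 2) * (2 * ennreal (std_normal_density y))"
        proof -
          have "2 * ennreal (std_normal_density y) = ennreal (2 * std_normal_density y)"
            by (simp add: ennreal_mult')
          then show ?thesis using pi_gt_zero by (subst ennreal_mult') auto
        qed
        finally show ?thesis using True by simp
      next
        case False
        with elim show ?thesis by simp
      qed
    qed
  qed
  also have "\<dots> = ennreal (pi / 2) * emeasure std_normal_distribution {y. q < y\<^sup>2}"
    unfolding std_normal_two_sided[OF q] by (subst nn_integral_cmult, simp)+ (simp add: emeasure_density)
  finally have "ennreal (2 / pi) * (\<integral>\<^sup>+v. ennreal (exp (- (q * (1 + v\<^sup>2) / 2)) / (1 + v\<^sup>2)) * indicator {0..} v \<partial>lborel)
    = ennreal (2 / pi) * (ennreal (pi / 2) * emeasure std_normal_distribution {y. q < y\<^sup>2})"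
    by simp
  also have "\<dots> = emeasure std_normal_distribution {y. q < y\<^sup>2}"
  proof -
    have "ennreal (2 / pi) * ennreal (pi / 2) = 1"
      by (subst ennreal_mult'[symmetric]) auto
    then show ?thesis by (simp only: mult.assoc[symmetric] mult_1)
  qed
  finally have "emeasure std_normal_distribution {y. q < y\<^sup>2}
    = (\<integral>\<^sup>+v. ennreal (2 / pi) * (ennreal (exp (- (q * (1 + v\<^sup>2) / 2)) / (1 + v\<^sup>2)) * indicator {0..} v) \<partial>lborel)"
    by (subst nn_integral_cmult) auto
  also have "\<dots> = (\<integral>\<^sup>+v. ennreal (2 / pi * exp (- (q * (1 + v\<^sup>2) / 2)) / (1 + v\<^sup>2)) * indicator {0..} v \<partial>lborel)"
  proof (intro nn_integral_cong)
    fix v :: real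
    have "ennreal (2 / pi) * ennreal (exp (- (q * (1 + v\<^sup>2) / 2)) / (1 + v\<^sup>2))
       = ennreal (2 / pi * exp (- (q * (1 + v\<^sup>2) / 2)) / (1 + v\<^sup>2))"
      by (subst ennreal_mult'[symmetric]) auto
    then show "ennreal (2 / pi) * (ennreal (exp (- (q * (1 + v\<^sup>2) / 2)) / (1 + v\<^sup>2)) * indicator {0..} v)
       = ennreal (2 / pi * exp (- (q * (1 + v\<^sup>2) / 2)) / (1 + v\<^sup>2)) * indicator {0..} v"
      by (simp only: mult.assoc[symmetric])
  qed
  finally show ?thesis .
qed

section \<open>Gaussian integrals of quadratic forms\<close>

lemma gauss_tilt:
  assumes "\<rho> > 0" "w \<ge> 0"
  shows "exp (- (w * y\<^sup>2 / 2)) * normal_density 0 \<rho> y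
    = 1 / sqrt (1 + w * \<rho>\<^sup>2) * normal_density 0 (\<rho> / sqrt (1 + w * \<rho>\<^sup>2)) y"
proof -
  define r where "r = sqrt (1 + w * \<rho>\<^sup>2)"
  have r: "r > 0" "r\<^sup>2 = 1 + w * \<rho>\<^sup>2" unfolding r_def using assms by (auto simp: add_pos_nonneg)
  have "y\<^sup>2 / (2 * (\<rho> / r)\<^sup>2) = w * y\<^sup>2 / 2 + y\<^sup>2 / (2 * \<rho>\<^sup>2)"
    using assms r by (simp add: power_divide field_simps)
  moreover have "sqrt (2 * pi * (\<rho> / r)\<^sup>2) = sqrt (2 * pi * \<rho>\<^sup>2) / r"
    using r(1) assms by (simp add: real_sqrt_mult power_divide real_sqrt_divide)
  ultimately show ?thesis
    using r(1) assms unfolding normal_density_def r_def[symmetric]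
    by (simp add: exp_add[symmetric] field_simps)
qed

lemma nn_integral_gauss_tilt:
  assumes "\<rho> > 0" "w \<ge> 0"
  shows "(\<integral>\<^sup>+y. ennreal (exp (- (w * y\<^sup>2 / 2))) * ennreal (normal_density 0 \<rho> y) \<partial>lborel) = ennreal (1 / sqrt (1 + w * \<rho>\<^sup>2))"
proof -
  have r: "sqrt (1 + w * \<rho>\<^sup>2) > 0" using assms by (auto simp: add_pos_nonneg)
  have "(\<integral>\<^sup>+y. ennreal (exp (- (w * y\<^sup>2 / 2))) * ennreal (normal_density 0 \<rho> y) \<partial>lborel)
    = (\<integral>\<^sup>+y. ennreal (1 / sqrt (1 + w * \<rho>\<^sup>2)) * ennreal (normal_density 0 (\<rho> / sqrt (1 + w * \<rho>\<^sup>2)) y) \<partial>lborel)"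
    using r by (intro nn_integral_cong) (simp add: ennreal_mult'[symmetric] gauss_tilt[OF assms] del: times_divide_eq_left)
  also have "\<dots> = ennreal (1 / sqrt (1 + w * \<rho>\<^sup>2))"
    using r assms by (subst nn_integral_cmult) (auto simp: nn_integral_eq_integral)
  finally show ?thesis .
qed

lemma PiM_normal_linear:
  fixes e \<tau> :: "'i \<Rightarrow> real"
  assumes I: "finite I" and \<tau>: "\<And>i. \<tau> i > 0" and e: "\<exists>i\<in>I. e i \<noteq> 0"
  shows "distributed (PiM I (\<lambda>i. density lborel (normal_density 0 (\<tau> i)))) lborel (\<lambda>z. \<Sum>i\<in>I. e i * z i)
    (normal_density 0 (sqrt (\<Sum>i\<in>I. (e i)\<^sup>2 * (\<tau> i)\<^sup>2)))"
proof -
  let ?N = "\<lambda>i. density lborel (\<lambda>x. ennreal (normal_density 0 (\<tau> i) x))"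
  have pN: "prob_space (?N i)" for i using \<tau> by (intro prob_space_normal_density)
  interpret product_prob_space ?N by (intro product_prob_spaceI pN)
  interpret P: prob_space "PiM I ?N" by (intro prob_space_PiM pN)
  define J where "J = {i\<in>I. e i \<noteq> 0}"
  have J: "finite J" "J \<noteq> {}" "J \<subseteq> I" using I e by (auto simp: J_def)
  have sets[measurable_cong]: "sets (PiM I ?N) = sets (PiM I (\<lambda>_. borel))" by (intro sets_PiM_cong) auto
  have D: "distr (PiM I ?N) borel (\<lambda>z. z i) = ?N i" if "i \<in> I" for i
  proof -
    have "distr (PiM I ?N) borel (\<lambda>z. z i) = distr (PiM I ?N) (?N i) (\<lambda>z. z i)" by (intro distr_cong) auto
    then show ?thesis using distr_PiM_component[of I ?N i] that I pN by simp
  qed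
  have ind: "P.indep_vars (\<lambda>_. borel) (\<lambda>i z. z i) I"
  proof -
    have ne: "I \<noteq> {}" using e by auto
    have "distr (PiM I ?N) (PiM I (\<lambda>_. borel)) (\<lambda>z. \<lambda>i\<in>I. z i) = distr (PiM I ?N) (PiM I ?N) (\<lambda>z. z)"
      by (intro distr_cong) (auto simp: space_PiM sets PiE_def extensional_restrict)
    also have "\<dots> = PiM I (\<lambda>i. distr (PiM I ?N) borel (\<lambda>z. z i))"
      by (simp add: D cong: PiM_cong)
    finally show ?thesis using ne by (subst P.indep_vars_iff_distr_eq_PiM') auto
  qed
  have "P.indep_vars (\<lambda>_. borel) (\<lambda>i z. e i * z i) J"
    using P.indep_vars_compose2[OF P.indep_vars_subset[OF ind J(3)], of "\<lambda>i y. e i * y" "\<lambda>_. borel"] by simp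
  moreover have "distributed (PiM I ?N) lborel (\<lambda>z. e i * z i) (normal_density 0 (\<bar>e i\<bar> * \<tau> i))" if "i \<in> J" for i
  proof -
    have "distributed (PiM I ?N) lborel (\<lambda>z. z i) (normal_density 0 (\<tau> i))"
    proof -
      have "distr (PiM I ?N) lborel (\<lambda>z. z i) = distr (PiM I ?N) borel (\<lambda>z. z i)" by (intro distr_cong) auto
      then show ?thesis using D[of i] that J(3) by (auto simp: distributed_def)
    qed
    then show ?thesis
      using P.normal_density_affine[of "\<lambda>z. z i" 0 "\<tau> i" "e i" 0] that \<tau> by (auto simp: J_def)
  qed
  ultimately have "distributed (PiM I ?N) lborel (\<lambda>z. \<Sum>i\<in>J. e i * z i) (normal_density (\<Sum>i\<in>J. 0) (sqrt (\<Sum>i\<in>J. (\<bar>e i\<bar> * \<tau> i)\<^sup>2)))"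
    using J \<tau> by (intro P.sum_indep_normal) (auto simp: J_def)
  moreover have "(\<Sum>i\<in>J. e i * z i) = (\<Sum>i\<in>I. e i * z i)" for z
    using I by (intro sum.mono_neutral_left) (auto simp: J_def)
  moreover have "(\<Sum>i\<in>J. (\<bar>e i\<bar> * \<tau> i)\<^sup>2) = (\<Sum>i\<in>I. (e i)\<^sup>2 * (\<tau> i)\<^sup>2)"
    using I by (auto intro!: sum.mono_neutral_cong_left simp: J_def power_mult_distrib)
  ultimately show ?thesis by simp
qed

text \<open>The diagonal part of the form changes the variances of the independent coordinates to \<open>1 / (1 + w i)\<close> and
contributes the product of the normalising constants. Under the new measure the linear form \<open>\<Sum>i\<in>I. e i * z i\<close>
is normal, so its square contributes a one-dimensional integral.\<close>
lemma gauss_prod_quadratic_form: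
  fixes e w :: "'i \<Rightarrow> real"
  assumes I: "finite I" and e: "\<exists>i\<in>I. e i \<noteq> 0" and u: "u \<ge> 0" and w: "\<And>i. w i \<ge> 0"
  shows "(\<integral>\<^sup>+z. ennreal (exp (- (u * (\<Sum>i\<in>I. e i * z i)\<^sup>2 + (\<Sum>i\<in>I. w i * (z i)\<^sup>2)) / 2)) \<partial>gauss_prod I)
    = ennreal ((\<Prod>i\<in>I. 1 / sqrt (1 + w i)) * (1 / sqrt (1 + u * (\<Sum>i\<in>I. (e i)\<^sup>2 / (1 + w i)))))"
proof -
  define \<tau> where "\<tau> i = 1 / sqrt (1 + w i)" for i
  have w1: "1 + w i > 0" for i using w[of i] by simp
  have \<tau>: "\<tau> i > 0" "(\<tau> i)\<^sup>2 = 1 / (1 + w i)" for i using w1[of i] by (auto simp: \<tau>_def power_divide)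
  define g where "g i y = ennreal (exp (- (w i * y\<^sup>2 / 2)) / \<tau> i)" for i y
  have [measurable]: "g i \<in> borel_measurable borel" for i unfolding g_def by measurable
  let ?N = "\<lambda>i. density lborel (\<lambda>x. ennreal (normal_density 0 (\<tau> i) x))"
  have pN: "prob_space (?N i)" for i using \<tau> by (intro prob_space_normal_density)
  interpret N: product_prob_space ?N by (intro product_prob_spaceI pN)
  interpret G: product_prob_space "\<lambda>_::'i. std_normal_distribution" by (rule product_prob_space_gauss)
  define Y where "Y z = (\<Sum>i\<in>I. e i * z i)" for z
  have [measurable]: "Y \<in> borel_measurable (PiM I (\<lambda>_. borel))" unfolding Y_def by measurable
  have dens: "density std_normal_distribution (g i) = ?N i" for i
  proof -
    have "ennreal (std_normal_density y) * g i y = ennreal (normal_density 0 (\<tau> i) y)" for y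
      using gauss_tilt[of 1 "w i" y] w[of i] \<tau>(1)[of i] unfolding g_def
      by (simp add: ennreal_mult'[symmetric] \<tau>_def[symmetric] field_simps)
    then show ?thesis by (subst density_density_eq) auto
  qed
  have PN: "density (gauss_prod I) (\<lambda>z. \<Prod>i\<in>I. g i (z i)) = PiM I ?N"
    unfolding dens[symmetric]
    by (rule density_PiM[OF I G.product_sigma_finite_axioms]) (auto simp: dens N.product_sigma_finite_axioms)
  have "(\<integral>\<^sup>+z. ennreal (exp (- (u * (Y z)\<^sup>2 + (\<Sum>i\<in>I. w i * (z i)\<^sup>2)) / 2)) \<partial>gauss_prod I)
    = (\<integral>\<^sup>+z. ennreal (\<Prod>i\<in>I. \<tau> i) * ((\<Prod>i\<in>I. g i (z i)) * ennreal (exp (- (u * (Y z)\<^sup>2 / 2)))) \<partial>gauss_prod I)"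
  proof (intro nn_integral_cong)
    fix z
    have "(\<Prod>i\<in>I. g i (z i)) = ennreal (\<Prod>i\<in>I. exp (- (w i * (z i)\<^sup>2 / 2)) / \<tau> i)"
      unfolding g_def using \<tau>(1) by (intro prod_ennreal) (auto intro: less_imp_le)
    also have "\<dots> = ennreal (exp (- (\<Sum>i\<in>I. w i * (z i)\<^sup>2) / 2) / (\<Prod>i\<in>I. \<tau> i))"
      by (simp add: prod_dividef exp_sum[OF I, symmetric] sum_negf sum_divide_distrib)
    finally have gprod: "(\<Prod>i\<in>I. g i (z i)) = ennreal (exp (- (\<Sum>i\<in>I. w i * (z i)\<^sup>2) / 2) / (\<Prod>i\<in>I. \<tau> i))" .
    have P: "(\<Prod>i\<in>I. \<tau> i) > 0" using \<tau>(1) by (intro prod_pos) auto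
    have "ennreal (\<Prod>i\<in>I. \<tau> i) * ((\<Prod>i\<in>I. g i (z i)) * ennreal (exp (- (u * (Y z)\<^sup>2 / 2))))
      = ennreal ((\<Prod>i\<in>I. \<tau> i) * (exp (- (\<Sum>i\<in>I. w i * (z i)\<^sup>2) / 2) / (\<Prod>i\<in>I. \<tau> i) * exp (- (u * (Y z)\<^sup>2 / 2))))"
      unfolding gprod mult.assoc using P
      by (subst ennreal_mult'', simp, subst ennreal_mult'', simp_all)
    also have "(\<Prod>i\<in>I. \<tau> i) * (exp (- (\<Sum>i\<in>I. w i * (z i)\<^sup>2) / 2) / (\<Prod>i\<in>I. \<tau> i) * exp (- (u * (Y z)\<^sup>2 / 2)))
      = exp (- (u * (Y z)\<^sup>2 + (\<Sum>i\<in>I. w i * (z i)\<^sup>2)) / 2)"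
      using P by (simp add: exp_add[symmetric] field_simps)
    finally show "ennreal (exp (- (u * (Y z)\<^sup>2 + (\<Sum>i\<in>I. w i * (z i)\<^sup>2)) / 2))
      = ennreal (\<Prod>i\<in>I. \<tau> i) * ((\<Prod>i\<in>I. g i (z i)) * ennreal (exp (- (u * (Y z)\<^sup>2 / 2))))" by simp
  qed
  also have "\<dots> = ennreal (\<Prod>i\<in>I. \<tau> i) * (\<integral>\<^sup>+z. (\<Prod>i\<in>I. g i (z i)) * ennreal (exp (- (u * (Y z)\<^sup>2 / 2))) \<partial>gauss_prod I)"
    by (intro nn_integral_cmult) measurable
  also have "(\<integral>\<^sup>+z. (\<Prod>i\<in>I. g i (z i)) * ennreal (exp (- (u * (Y z)\<^sup>2 / 2))) \<partial>gauss_prod I)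
    = (\<integral>\<^sup>+z. ennreal (exp (- (u * (Y z)\<^sup>2 / 2))) \<partial>PiM I ?N)"
    unfolding PN[symmetric] by (subst nn_integral_density) auto
  also have "\<dots> = (\<integral>\<^sup>+y. ennreal (normal_density 0 (sqrt (\<Sum>i\<in>I. (e i)\<^sup>2 * (\<tau> i)\<^sup>2)) y) * ennreal (exp (- (u * y\<^sup>2 / 2))) \<partial>lborel)"
    unfolding Y_def
    by (intro distributed_nn_integral[symmetric] PiM_normal_linear I \<tau> e) measurable
  also have "\<dots> = ennreal (1 / sqrt (1 + u * (sqrt (\<Sum>i\<in>I. (e i)\<^sup>2 * (\<tau> i)\<^sup>2))\<^sup>2))"
  proof -
    obtain k where k: "k \<in> I" "e k \<noteq> 0" using e by auto
    have "(\<Sum>i\<in>I. (e i)\<^sup>2 * (\<tau> i)\<^sup>2) > 0"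
      using k \<tau>(1)[of k] by (intro sum_pos2[OF I, of k]) auto
    then show ?thesis using u by (subst mult.commute) (intro nn_integral_gauss_tilt, auto)
  qed
  also have "(sqrt (\<Sum>i\<in>I. (e i)\<^sup>2 * (\<tau> i)\<^sup>2))\<^sup>2 = (\<Sum>i\<in>I. (e i)\<^sup>2 / (1 + w i))"
    using less_imp_le[OF w1] by (subst real_sqrt_pow2) (auto simp: \<tau>(2) intro!: sum_nonneg sum.cong)
  finally show ?thesis
    using less_imp_le[OF \<tau>(1)] unfolding Y_def \<tau>_def[symmetric] by (subst ennreal_mult') (auto intro: prod_nonneg)
qed

section \<open>The probability of the cone\<close>

text \<open>The event to be studied is that the quadratic form \<open>S z ^ 2 - A * V2 z\<close> is positive. Its matrix, the
rank-one matrix of \<open>\<sigma>\<close> minus a nonnegative diagonal one, has at most one positive eigenvalue, and the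
equation \<open>balanced\<close> says that this eigenvalue is 1. The event does not change when all scales are multiplied by
the same positive number, so this is only a normalisation. The corresponding unit eigenvector is \<open>e\<close>, with
component \<open>Y\<close>, and \<open>q\<close> is minus the form on the orthogonal complement of \<open>e\<close>: the event is \<open>q z < Y z ^ 2\<close>,
where \<open>q\<close> does not change under shifts along \<open>e\<close>.\<close>
locale balanced_scales =
  fixes I :: "'i set" and \<sigma> :: "'i \<Rightarrow> real" and A :: real
  assumes fin: "finite I" and A: "A > 0"
    and balanced: "(\<Sum>i\<in>I. (\<sigma> i)\<^sup>2 / (1 + A * (\<sigma> i)\<^sup>2)) = 1"
begin

definition \<kappa> :: real where
  "\<kappa> = 1 / sqrt (\<Sum>i\<in>I. (\<sigma> i)\<^sup>2 / (1 + A * (\<sigma> i)\<^sup>2)\<^sup>2)"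

definition e :: "'i \<Rightarrow> real" where
  "e i = \<kappa> * \<sigma> i / (1 + A * (\<sigma> i)\<^sup>2)"

definition S :: "('i \<Rightarrow> real) \<Rightarrow> real" where "S z = (\<Sum>i\<in>I. \<sigma> i * z i)"

definition V2 :: "('i \<Rightarrow> real) \<Rightarrow> real" where "V2 z = (\<Sum>i\<in>I. (\<sigma> i)\<^sup>2 * (z i)\<^sup>2)"

definition Y :: "('i \<Rightarrow> real) \<Rightarrow> real" where "Y z = (\<Sum>i\<in>I. e i * z i)"

definition q :: "('i \<Rightarrow> real) \<Rightarrow> real" where "q z = (Y z)\<^sup>2 - ((S z)\<^sup>2 - A * V2 z)"

definition shift :: "real \<Rightarrow> ('i \<Rightarrow> real) \<Rightarrow> 'i \<Rightarrow> real" where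
  "shift s z = (\<lambda>i\<in>I. z i + s * e i)"

lemma den_pos: "1 + A * (\<sigma> i)\<^sup>2 > 0"
  using A by (simp add: add_pos_nonneg)

lemma sum_sq_pos: "(\<Sum>i\<in>I. (\<sigma> i)\<^sup>2 / (1 + A * (\<sigma> i)\<^sup>2)\<^sup>2) > 0"
proof -
  have "\<exists>k\<in>I. \<sigma> k \<noteq> 0"
  proof (rule ccontr)
    assume "\<not> ?thesis"
    then have "(\<Sum>i\<in>I. (\<sigma> i)\<^sup>2 / (1 + A * (\<sigma> i)\<^sup>2)) = 0" by simp
    with balanced show False by simp
  qed
  then obtain k where k: "k \<in> I" "\<sigma> k \<noteq> 0" by auto
  then show ?thesis using den_pos[of k]
    by (intro sum_pos2[OF fin, of k]) auto
qed

lemma \<kappa>_pos: "\<kappa> > 0" and \<kappa>_sq: "\<kappa>\<^sup>2 * (\<Sum>i\<in>I. (\<sigma> i)\<^sup>2 / (1 + A * (\<sigma> i)\<^sup>2)\<^sup>2) = 1"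
  using sum_sq_pos by (simp_all add: \<kappa>_def power_divide)

lemma e_norm: "(\<Sum>i\<in>I. (e i)\<^sup>2) = 1"
proof -
  have "(\<Sum>i\<in>I. (e i)\<^sup>2) = \<kappa>\<^sup>2 * (\<Sum>i\<in>I. (\<sigma> i)\<^sup>2 / (1 + A * (\<sigma> i)\<^sup>2)\<^sup>2)"
    by (simp add: e_def power_mult_distrib power_divide sum_distrib_left)
  then show ?thesis by (simp only: \<kappa>_sq)
qed

lemma S_e: "(\<Sum>i\<in>I. \<sigma> i * e i) = \<kappa>"
proof -
  have "(\<Sum>i\<in>I. \<sigma> i * e i) = \<kappa> * (\<Sum>i\<in>I. (\<sigma> i)\<^sup>2 / (1 + A * (\<sigma> i)\<^sup>2))"
    by (simp add: e_def sum_distrib_left power2_eq_square mult_ac)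
  then show ?thesis by (simp add: balanced)
qed

lemma eigen: "e i + A * ((\<sigma> i)\<^sup>2 * e i) = \<kappa> * \<sigma> i"
proof -
  have "e i * (1 + A * (\<sigma> i)\<^sup>2) = \<kappa> * \<sigma> i" using den_pos[of i] by (simp add: e_def)
  then show ?thesis by (simp add: algebra_simps)
qed

lemma Y_shift: "Y (shift s z) = Y z + s"
proof -
  have "Y (shift s z) = Y z + s * (\<Sum>i\<in>I. (e i)\<^sup>2)"
    by (simp add: Y_def shift_def algebra_simps sum.distrib power2_eq_square sum_distrib_left)
  then show ?thesis by (simp add: e_norm)
qed

lemma S_shift: "S (shift s z) = S z + s * \<kappa>"
proof -
  have "S (shift s z) = S z + s * (\<Sum>i\<in>I. \<sigma> i * e i)"
    by (simp add: S_def shift_def algebra_simps sum.distrib sum_distrib_left)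
  then show ?thesis by (simp add: S_e)
qed

lemma V2_shift: "A * V2 (shift s z) = A * V2 z + 2 * s * (\<kappa> * S z - Y z) + s\<^sup>2 * (\<kappa>\<^sup>2 - 1)"
proof -
  have ae: "A * ((\<sigma> i)\<^sup>2 * e i) = \<kappa> * \<sigma> i - e i" for i using eigen[of i] by simp
  have "A * V2 (shift s z) = A * V2 z + 2 * s * (\<Sum>i\<in>I. A * ((\<sigma> i)\<^sup>2 * e i) * z i)
      + s\<^sup>2 * (\<Sum>i\<in>I. A * ((\<sigma> i)\<^sup>2 * e i) * e i)"
    by (simp add: V2_def shift_def algebra_simps sum.distrib sum_distrib_left power2_eq_square)
  also have "(\<Sum>i\<in>I. A * ((\<sigma> i)\<^sup>2 * e i) * z i) = \<kappa> * S z - Y z"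
    unfolding ae by (simp add: S_def Y_def algebra_simps sum_subtractf sum_distrib_left)
  also have "(\<Sum>i\<in>I. A * ((\<sigma> i)\<^sup>2 * e i) * e i) = \<kappa> * (\<Sum>i\<in>I. \<sigma> i * e i) - (\<Sum>i\<in>I. (e i)\<^sup>2)"
    unfolding ae by (simp add: algebra_simps sum_subtractf sum_distrib_left power2_eq_square)
  finally show ?thesis unfolding S_e e_norm by (simp add: power2_eq_square)
qed

lemma q_shift: "q (shift s z) = q z"
proof -
  have "((y + s)\<^sup>2 - ((x + s * k)\<^sup>2 - (v + 2 * s * (k * x - y) + s\<^sup>2 * (k\<^sup>2 - 1)))) = y\<^sup>2 - (x\<^sup>2 - v)"
    for y x v k :: real by algebra
  then show ?thesis unfolding q_def Y_shift S_shift V2_shift .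
qed

text \<open>Since \<open>q\<close> is invariant along \<open>e\<close> and \<open>S\<close> is not, \<open>z\<close> can be shifted to a point with \<open>S = 0\<close>, where
\<open>q\<close> is visibly a sum of squares.\<close>
lemma q_nonneg: "q z \<ge> 0"
proof -
  define s where "s = - S z / \<kappa>"
  have "S (shift s z) = 0" using \<kappa>_pos by (simp add: S_shift s_def)
  then have "q (shift s z) = (Y (shift s z))\<^sup>2 + A * V2 (shift s z)" by (simp add: q_def)
  also have "\<dots> \<ge> 0" using A by (simp add: V2_def sum_nonneg)
  finally show ?thesis by (simp add: q_shift)
qed

lemma measurable_forms[measurable]:
  "S \<in> borel_measurable (PiM I (\<lambda>_. borel))" "V2 \<in> borel_measurable (PiM I (\<lambda>_. borel))"
  "Y \<in> borel_measurable (PiM I (\<lambda>_. borel))" "q \<in> borel_measurable (PiM I (\<lambda>_. borel))"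
proof -
  show *[measurable]: "S \<in> borel_measurable (PiM I (\<lambda>_. borel))" "V2 \<in> borel_measurable (PiM I (\<lambda>_. borel))"
    "Y \<in> borel_measurable (PiM I (\<lambda>_. borel))"
    unfolding S_def V2_def Y_def by measurable
  show "q \<in> borel_measurable (PiM I (\<lambda>_. borel))" unfolding q_def by measurable
qed

lemma resample:
  assumes "f \<in> borel_measurable (PiM I (\<lambda>_. borel))"
  shows "(\<integral>\<^sup>+z. f z \<partial>gauss_prod I) =
    (\<integral>\<^sup>+z. (\<integral>\<^sup>+s. ennreal (std_normal_density (Y z + s)) * f (shift s z) \<partial>lborel) \<partial>gauss_prod I)"
  using gauss_prod_resample[OF fin e_norm assms] by (simp add: Y_def shift_def)

text \<open>Resampling along \<open>e\<close> replaces \<open>Y\<close> by a standard normal variable independent of \<open>q\<close>.\<close>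
lemma cone_prob_eq_expectation:
  "emeasure (gauss_prod I) {z \<in> space (gauss_prod I). A * V2 z < (S z)\<^sup>2}
    = (\<integral>\<^sup>+z. emeasure std_normal_distribution {y. q z < y\<^sup>2} \<partial>gauss_prod I)"
proof -
  define f where "f z = (indicator {y. q z < y\<^sup>2} (Y z) :: ennreal)" for z
  have [measurable]: "f \<in> borel_measurable (PiM I (\<lambda>_. borel))"
    unfolding f_def[abs_def] indicator_def mem_Collect_eq by measurable
  have "emeasure (gauss_prod I) {z \<in> space (gauss_prod I). A * V2 z < (S z)\<^sup>2} = (\<integral>\<^sup>+z. f z \<partial>gauss_prod I)"
  proof -
    have "(\<integral>\<^sup>+z. f z \<partial>gauss_prod I) = (\<integral>\<^sup>+z. indicator {z \<in> space (gauss_prod I). A * V2 z < (S z)\<^sup>2} z \<partial>gauss_prod I)"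
      by (intro nn_integral_cong) (simp add: f_def q_def indicator_def)
    then show ?thesis by (subst (asm) nn_integral_indicator) auto
  qed
  also have "\<dots> = (\<integral>\<^sup>+z. (\<integral>\<^sup>+s. ennreal (std_normal_density (Y z + s)) * f (shift s z) \<partial>lborel) \<partial>gauss_prod I)"
    by (rule resample) measurable
  also have "\<dots> = (\<integral>\<^sup>+z. emeasure std_normal_distribution {y. q z < y\<^sup>2} \<partial>gauss_prod I)"
  proof (intro nn_integral_cong)
    fix z
    have "(\<integral>\<^sup>+s. ennreal (std_normal_density (Y z + s)) * f (shift s z) \<partial>lborel)
      = (\<integral>\<^sup>+s. ennreal (std_normal_density (Y z + 1 * s)) * indicator {y. q z < y\<^sup>2} (Y z + 1 * s) \<partial>lborel)"
      by (simp add: f_def q_shift Y_shift)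
    also have "\<dots> = (\<integral>\<^sup>+y. ennreal (std_normal_density y) * indicator {y. q z < y\<^sup>2} y \<partial>lborel)"
      by (subst (2) nn_integral_real_affine[where c = 1 and t = "Y z"]) auto
    also have "\<dots> = emeasure std_normal_distribution {y. q z < y\<^sup>2}"
      by (simp add: emeasure_density)
    finally show "(\<integral>\<^sup>+s. ennreal (std_normal_density (Y z + s)) * f (shift s z) \<partial>lborel)
      = emeasure std_normal_distribution {y. q z < y\<^sup>2}" .
  qed
  finally show ?thesis .
qed

text \<open>The form \<open>q\<close> is diagonal plus two rank-one terms of opposite signs, which makes a direct integration awkward.
Instead the resampling identity is read backwards: it is applied to a function that contains neither
\<open>S\<close> nor a negative term. This function is \<open>exp (- t * q / 2)\<close> times \<open>exp (Y ^ 2 / 2 - t * S ^ 2 / 2)\<close>. Resampling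
along \<open>e\<close> leaves the first factor alone, and the integral of the second against the density of the new
component is a Gaussian integral in \<open>S z + s * \<kappa>\<close>, which does not depend on \<open>z\<close>.\<close>
lemma laplace_q_reduction:
  assumes t: "t \<ge> 1"
  shows "(\<integral>\<^sup>+z. ennreal (exp (- (t * q z / 2))) \<partial>gauss_prod I)
    = ennreal (\<kappa> * sqrt t) * (\<integral>\<^sup>+z. ennreal (exp (- ((t - 1) * (Y z)\<^sup>2 + t * A * V2 z) / 2)) \<partial>gauss_prod I)"
proof -
  define f where "f z = ennreal (exp (- ((t - 1) * (Y z)\<^sup>2 + t * A * V2 z) / 2))" for z
  \<comment> \<open>As a function of the shift, the factor in \<open>S\<close> is a Gaussian with this standard deviation, centred where \<open>S\<close> vanishes.\<close>
  define r where "r = 1 / (\<kappa> * sqrt t)"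
  have r: "r > 0" using \<kappa>_pos t by (simp add: r_def)
  have [measurable]: "f \<in> borel_measurable (PiM I (\<lambda>_. borel))" unfolding f_def[abs_def] by measurable
  have "(\<integral>\<^sup>+z. f z \<partial>gauss_prod I)
    = (\<integral>\<^sup>+z. (\<integral>\<^sup>+s. ennreal (std_normal_density (Y z + s)) * f (shift s z) \<partial>lborel) \<partial>gauss_prod I)"
    by (rule resample) measurable
  also have "\<dots> = (\<integral>\<^sup>+z. ennreal r * ennreal (exp (- (t * q z / 2))) \<partial>gauss_prod I)"
  proof (intro nn_integral_cong)
    fix z
    have "std_normal_density (Y z + s) * exp (- ((t - 1) * (Y (shift s z))\<^sup>2 + t * A * V2 (shift s z)) / 2)
      = r * exp (- (t * q z / 2)) * normal_density (- S z / \<kappa>) r s" for s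
    proof -
      have "(S z + s * \<kappa>) = \<kappa> * (s - (- S z / \<kappa>))" using \<kappa>_pos by (simp add: field_simps)
      then have "t * (S z + s * \<kappa>)\<^sup>2 / 2 = (s - (- S z / \<kappa>))\<^sup>2 / (2 * r\<^sup>2)"
        using \<kappa>_pos t by (simp add: r_def power_mult_distrib power_divide)
      moreover have qz: "q z = (Y z + s)\<^sup>2 - ((S z + s * \<kappa>)\<^sup>2 - A * V2 (shift s z))"
        using q_shift[of s z] unfolding q_def Y_shift S_shift by simp
      then have "- ((Y z + s)\<^sup>2 / 2) + - ((t - 1) * (Y (shift s z))\<^sup>2 + t * A * V2 (shift s z)) / 2
        = - (t * q z / 2) + - (t * (S z + s * \<kappa>)\<^sup>2 / 2)"
      proof -
        have "- (a\<^sup>2 / 2) + - ((t - 1) * a\<^sup>2 + t * A * V) / 2 = - (t * (a\<^sup>2 - (c\<^sup>2 - A * V)) / 2) + - (t * c\<^sup>2 / 2)"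
          for a c V :: real by (simp add: field_simps)
        then show ?thesis unfolding qz Y_shift .
      qed
      ultimately have "exp (- ((Y z + s)\<^sup>2 / 2)) * exp (- ((t - 1) * (Y (shift s z))\<^sup>2 + t * A * V2 (shift s z)) / 2)
        = exp (- (t * q z / 2)) * exp (- ((s - (- S z / \<kappa>))\<^sup>2 / (2 * r\<^sup>2)))"
        by (simp only: exp_add[symmetric])
      then show ?thesis using r
        unfolding normal_density_def by (simp add: real_sqrt_mult)
    qed
    then have "(\<integral>\<^sup>+s. ennreal (std_normal_density (Y z + s)) * f (shift s z) \<partial>lborel)
      = (\<integral>\<^sup>+s. ennreal (r * exp (- (t * q z / 2))) * ennreal (normal_density (- S z / \<kappa>) r s) \<partial>lborel)"
      using r unfolding f_def by (intro nn_integral_cong) (simp add: ennreal_mult'[symmetric])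
    also have "\<dots> = ennreal (r * exp (- (t * q z / 2)))"
      using r by (subst nn_integral_cmult) (auto simp: nn_integral_eq_integral)
    also have "\<dots> = ennreal r * ennreal (exp (- (t * q z / 2)))"
      using r by (simp add: ennreal_mult')
    finally show "(\<integral>\<^sup>+s. ennreal (std_normal_density (Y z + s)) * f (shift s z) \<partial>lborel)
      = ennreal r * ennreal (exp (- (t * q z / 2)))" .
  qed
  also have "\<dots> = ennreal r * (\<integral>\<^sup>+z. ennreal (exp (- (t * q z / 2))) \<partial>gauss_prod I)"
    by (intro nn_integral_cmult) measurable
  finally have "ennreal (\<kappa> * sqrt t) * (\<integral>\<^sup>+z. f z \<partial>gauss_prod I)
    = ennreal (\<kappa> * sqrt t) * ennreal r * (\<integral>\<^sup>+z. ennreal (exp (- (t * q z / 2))) \<partial>gauss_prod I)"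
    by (simp add: mult.assoc)
  moreover have "ennreal (\<kappa> * sqrt t) * ennreal r = 1"
    using \<kappa>_pos t by (subst ennreal_mult'[symmetric]) (auto simp: r_def)
  ultimately show ?thesis by (simp add: f_def)
qed

text \<open>In the variables \<open>b i\<close> the normalisation becomes \<open>\<Sum>i\<in>I. b i = A\<close>, and the Laplace transform of \<open>q\<close> becomes
the symmetric function \<open>G\<close> raised to the power \<open>- 1 / 2\<close>. In the limit where all \<open>b i\<close> tend to 0 with constant sum,
\<open>G u\<close> tends to \<open>exp ((1 + u) * A)\<close>, and the formula for the cone turns into Craig's formula for
a standard normal variable.\<close>
definition b :: "'i \<Rightarrow> real" where "b i = A * (\<sigma> i)\<^sup>2 / (1 + A * (\<sigma> i)\<^sup>2)"

lemma b_bounds: "0 \<le> b i" "b i < 1"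
  using den_pos[of i] A by (auto simp: b_def)

lemma sum_b: "(\<Sum>i\<in>I. b i) = A"
proof -
  have "(\<Sum>i\<in>I. b i) = A * (\<Sum>i\<in>I. (\<sigma> i)\<^sup>2 / (1 + A * (\<sigma> i)\<^sup>2))"
    by (simp add: b_def sum_distrib_left)
  then show ?thesis by (simp add: balanced)
qed

definition G :: "real \<Rightarrow> real" where
  "G u = (\<Prod>i\<in>I. (1 + u * b i) / (1 - b i)) * (\<Sum>i\<in>I. b i * (1 - b i) / (1 + u * b i)) / A"

text \<open>The constant \<open>\<kappa>\<close> disappears because 1 can be written as \<open>\<Sum>i\<in>I. (e i)\<^sup>2\<close>; after this the two sides agree
term by term.\<close>
lemma laplace_q:
  assumes u: "u \<ge> 0"
  shows "(\<integral>\<^sup>+z. ennreal (exp (- ((1 + u) * q z / 2))) \<partial>gauss_prod I) = ennreal (1 / sqrt (G u))"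
proof -
  define w where "w i = (1 + u) * A * (\<sigma> i)\<^sup>2" for i
  have w: "w i \<ge> 0" for i using A u by (simp add: w_def)
  have w1: "1 + w i > 0" for i using w[of i] by simp
  have e0: "\<exists>i\<in>I. e i \<noteq> 0"
  proof (rule ccontr)
    assume "\<not> ?thesis"
    then have "(\<Sum>i\<in>I. (e i)\<^sup>2) = 0" by simp
    with e_norm show False by simp
  qed
  have prodeq: "(1 + u * b i) / (1 - b i) = 1 + w i" for i
    using den_pos[of i] by (simp add: b_def w_def field_simps)
  have sumeq: "1 + u * (\<Sum>i\<in>I. (e i)\<^sup>2 / (1 + w i)) = \<kappa>\<^sup>2 * (1 + u) * ((\<Sum>i\<in>I. b i * (1 - b i) / (1 + u * b i)) / A)"
  proof -
    have "1 + u * (\<Sum>i\<in>I. (e i)\<^sup>2 / (1 + w i)) = (\<Sum>i\<in>I. (e i)\<^sup>2 * (1 + u / (1 + w i)))"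
      using e_norm by (simp add: algebra_simps sum.distrib sum_distrib_left)
    also have "\<dots> = (\<Sum>i\<in>I. \<kappa>\<^sup>2 * (1 + u) * (b i * (1 - b i) / (1 + u * b i) / A))"
    proof (intro sum.cong refl)
      fix i
      define d where "d = 1 + A * (\<sigma> i)\<^sup>2"
      have d: "d > 0" unfolding d_def by (rule den_pos)
      have s: "(\<sigma> i)\<^sup>2 = (d - 1) / A" using A by (simp add: d_def)
      have wi: "1 + w i = d + u * (d - 1)" using A by (simp add: w_def s field_simps)
      have bi: "b i = (d - 1) / d" using A by (simp add: b_def s)
      have ub: "1 + u * b i = (d + u * (d - 1)) / d" using d by (simp add: bi field_simps)
      have pos: "d + u * (d - 1) > 0" using w1[of i] wi by simp
      have ei: "(e i)\<^sup>2 = \<kappa>\<^sup>2 * ((d - 1) / A) / d\<^sup>2"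
        unfolding e_def d_def[symmetric] by (simp add: power_divide power_mult_distrib s)
      have b1: "1 - b i = 1 / d" using d by (simp add: bi field_simps)
      have R: "b i * (1 - b i) / (1 + u * b i) = (d - 1) / (d * (d + u * (d - 1)))"
      proof -
        have "(d - 1) / d * (1 / d) / (x / d) = (d - 1) / (d * x)" if "x > 0" for x
          using d that by (simp add: field_simps)
        from this[OF pos] show ?thesis unfolding ub b1 unfolding bi .
      qed
      have "1 + u / (1 + w i) = d * (1 + u) / (d + u * (d - 1))"
        unfolding wi using pos by (simp add: field_simps)
      then show "(e i)\<^sup>2 * (1 + u / (1 + w i)) = \<kappa>\<^sup>2 * (1 + u) * (b i * (1 - b i) / (1 + u * b i) / A)"
        unfolding R ei using d pos A by (simp add: power2_eq_square mult_ac)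
    qed
    finally show ?thesis by (simp add: sum_distrib_left sum_divide_distrib)
  qed
  have "(\<integral>\<^sup>+z. ennreal (exp (- ((1 + u) * q z / 2))) \<partial>gauss_prod I)
    = ennreal (\<kappa> * sqrt (1 + u)) * (\<integral>\<^sup>+z. ennreal (exp (- (u * (\<Sum>i\<in>I. e i * z i)\<^sup>2 + (\<Sum>i\<in>I. w i * (z i)\<^sup>2)) / 2)) \<partial>gauss_prod I)"
    using laplace_q_reduction[of "1 + u"] u
    by (simp add: Y_def V2_def w_def sum_distrib_left mult.assoc)
  also have "\<dots> = ennreal (\<kappa> * sqrt (1 + u)) *
     ennreal ((\<Prod>i\<in>I. 1 / sqrt (1 + w i)) * (1 / sqrt (1 + u * (\<Sum>i\<in>I. (e i)\<^sup>2 / (1 + w i)))))"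
    by (subst gauss_prod_quadratic_form[OF fin e0 u w]) simp
  also have "\<dots> = ennreal (\<kappa> * sqrt (1 + u) * ((\<Prod>i\<in>I. 1 / sqrt (1 + w i)) * (1 / sqrt (1 + u * (\<Sum>i\<in>I. (e i)\<^sup>2 / (1 + w i))))))"
    using \<kappa>_pos u by (subst ennreal_mult') auto
  also have "\<kappa> * sqrt (1 + u) * ((\<Prod>i\<in>I. 1 / sqrt (1 + w i)) * (1 / sqrt (1 + u * (\<Sum>i\<in>I. (e i)\<^sup>2 / (1 + w i))))) = 1 / sqrt (G u)"
  proof -
    have p: "(\<Prod>i\<in>I. 1 / sqrt (1 + w i)) = 1 / sqrt (\<Prod>i\<in>I. 1 + w i)"
      by (induction I rule: infinite_finite_induct) (auto simp: real_sqrt_mult)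
    have G: "G u = (\<Prod>i\<in>I. 1 + w i) * ((\<Sum>i\<in>I. b i * (1 - b i) / (1 + u * b i)) / A)"
      by (simp add: G_def prodeq)
    show ?thesis unfolding sumeq p G using \<kappa>_pos u by (simp add: real_sqrt_mult real_sqrt_divide)
  qed
  finally show ?thesis .
qed

theorem cone_probability:
  "emeasure (gauss_prod I) {z \<in> space (gauss_prod I). A * V2 z < (S z)\<^sup>2}
    = (\<integral>\<^sup>+v. ennreal (2 / pi / ((1 + v\<^sup>2) * sqrt (G (v\<^sup>2)))) * indicator {0..} v \<partial>lborel)"
proof -
  interpret GP: prob_space "gauss_prod I" by (rule prob_space_gauss_prod)
  interpret P: pair_sigma_finite "gauss_prod I" lborel ..
  have "emeasure (gauss_prod I) {z \<in> space (gauss_prod I). A * V2 z < (S z)\<^sup>2}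
    = (\<integral>\<^sup>+z. (\<integral>\<^sup>+v. ennreal (2 / pi * exp (- (q z * (1 + v\<^sup>2) / 2)) / (1 + v\<^sup>2)) * indicator {0..} v \<partial>lborel) \<partial>gauss_prod I)"
    unfolding cone_prob_eq_expectation by (intro nn_integral_cong craig_formula q_nonneg)
  also have "\<dots> = (\<integral>\<^sup>+v. (\<integral>\<^sup>+z. ennreal (2 / pi * exp (- (q z * (1 + v\<^sup>2) / 2)) / (1 + v\<^sup>2)) * indicator {0..} v \<partial>gauss_prod I) \<partial>lborel)"
    by (rule P.Fubini'[symmetric]) measurable
  also have "\<dots> = (\<integral>\<^sup>+v. ennreal (2 / pi / ((1 + v\<^sup>2) * sqrt (G (v\<^sup>2)))) * indicator {0..} v \<partial>lborel)"
  proof (intro nn_integral_cong)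
    fix v :: real
    have p: "1 + v\<^sup>2 > 0" by (simp add: add_pos_nonneg)
    have "(\<integral>\<^sup>+z. ennreal (2 / pi * exp (- (q z * (1 + v\<^sup>2) / 2)) / (1 + v\<^sup>2)) * indicator {0..} v \<partial>gauss_prod I)
      = (\<integral>\<^sup>+z. ennreal (2 / pi / (1 + v\<^sup>2)) * indicator {0..} v * ennreal (exp (- ((1 + v\<^sup>2) * q z / 2))) \<partial>gauss_prod I)"
      using p by (intro nn_integral_cong) (simp add: ennreal_mult'[symmetric] indicator_def mult.commute)
    also have "\<dots> = ennreal (2 / pi / (1 + v\<^sup>2)) * indicator {0..} v * ennreal (1 / sqrt (G (v\<^sup>2)))"
      by (subst nn_integral_cmult) (auto simp: laplace_q)
    also have "\<dots> = ennreal (2 / pi / ((1 + v\<^sup>2) * sqrt (G (v\<^sup>2)))) * indicator {0..} v"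
      using p by (auto simp add: ennreal_mult'[symmetric] indicator_def mult.assoc)
    finally show "(\<integral>\<^sup>+z. ennreal (2 / pi * exp (- (q z * (1 + v\<^sup>2) / 2)) / (1 + v\<^sup>2)) * indicator {0..} v \<partial>gauss_prod I)
      = ennreal (2 / pi / ((1 + v\<^sup>2) * sqrt (G (v\<^sup>2)))) * indicator {0..} v" .
  qed
  finally show ?thesis .
qed

end

section \<open>Equal small weights are extremal when the level is at least 3\<close>

text \<open>The weights are \<open>b i\<close> for \<open>i\<close> in \<open>I\<close>, together with \<open>m\<close> copies of a value \<open>\<tau>\<close> that is at least as large as all of
them. The missing mass \<open>slack\<close>, up to the total \<open>A\<close>, stands for infinitely many infinitesimal weights: it enters
the logarithm of \<open>G\<close> through the limit \<open>(1 + u) * slack\<close> of the corresponding factors. Lowering \<open>\<tau>\<close> thus breaks the largest weights into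
dust. The extreme case in which everything is dust is the normal distribution.\<close>
definition slack :: "'i set \<Rightarrow> ('i \<Rightarrow> real) \<Rightarrow> nat \<Rightarrow> real \<Rightarrow> real \<Rightarrow> real" where
  "slack I b m A \<tau> = A - real m * \<tau> - (\<Sum>i\<in>I. b i)"

definition wsum :: "'i set \<Rightarrow> ('i \<Rightarrow> real) \<Rightarrow> nat \<Rightarrow> real \<Rightarrow> real \<Rightarrow> real \<Rightarrow> real" where
  "wsum I b m A \<tau> u = slack I b m A \<tau> + (\<Sum>i\<in>I. b i * (1 - b i) / (1 + u * b i))
     + real m * (\<tau> * (1 - \<tau>) / (1 + u * \<tau>))"

definition logG :: "'i set \<Rightarrow> ('i \<Rightarrow> real) \<Rightarrow> nat \<Rightarrow> real \<Rightarrow> real \<Rightarrow> real \<Rightarrow> real" where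
  "logG I b m A \<tau> u = (1 + u) * slack I b m A \<tau> + (\<Sum>i\<in>I. ln (1 + u * b i) - ln (1 - b i))
     + real m * (ln (1 + u * \<tau>) - ln (1 - \<tau>)) + ln (wsum I b m A \<tau> u / A)"

locale capped_weights =
  fixes I :: "'i set" and b :: "'i \<Rightarrow> real" and m :: nat and A :: real
  assumes fin: "finite I" and b0: "\<And>i. i \<in> I \<Longrightarrow> 0 \<le> b i" and A3: "A \<ge> 3"
begin

abbreviation "c \<tau> \<equiv> slack I b m A \<tau>"
abbreviation "W \<tau> u \<equiv> wsum I b m A \<tau> u"
abbreviation "L \<tau> u \<equiv> logG I b m A \<tau> u"

definition cap :: "real \<Rightarrow> bool" where
  "cap \<tau> \<longleftrightarrow> 0 \<le> \<tau> \<and> \<tau> < 1 \<and> (\<forall>i\<in>I. b i \<le> \<tau>) \<and> c \<tau> \<ge> 0"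

lemma total: "c \<tau> + (\<Sum>i\<in>I. b i) + real m * \<tau> = A"
  by (simp add: slack_def)

lemma lin_pos: "0 \<le> x \<Longrightarrow> 0 \<le> u \<Longrightarrow> 1 + u * x > (0::real)"
  by (simp add: add_pos_nonneg)

text \<open>Every weight is at most \<open>\<tau>\<close>, so it contributes at least \<open>(1 - \<tau>) / (1 + u * \<tau>)\<close> times its size; equality
holds when all mass sits at \<open>\<tau>\<close>.\<close>
lemma wsum_lower:
  assumes "cap \<tau>" "u \<ge> 0"
  shows "A * (1 - \<tau>) / (1 + u * \<tau>) \<le> W \<tau> u"
proof -
  have t: "0 \<le> \<tau>" "\<tau> < 1" "c \<tau> \<ge> 0" and bt: "\<And>i. i \<in> I \<Longrightarrow> b i \<le> \<tau>"
    using assms(1) by (auto simp: cap_def)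
  define k where "k = (1 - \<tau>) / (1 + u * \<tau>)"
  have p: "1 + u * \<tau> > 0" using lin_pos t assms by simp
  have "1 - \<tau> \<le> 1" using t by simp
  also have "1 \<le> 1 * (1 + u * \<tau>)" using t assms(2) by simp
  finally have "1 - \<tau> \<le> 1 * (1 + u * \<tau>)" .
  then have k1: "k \<le> 1" using p by (simp add: k_def divide_le_eq)
  have "b i * k \<le> b i * (1 - b i) / (1 + u * b i)" if "i \<in> I" for i
  proof -
    have "k \<le> (1 - b i) / (1 + u * b i)"
      unfolding k_def using bt[OF that] b0[OF that] t assms(2) lin_pos[OF b0[OF that] assms(2)]
      by (intro frac_le) (auto intro: mult_left_mono)
    then show ?thesis using mult_left_mono[OF _ b0[OF that]] by fastforce
  qed
  then have "(\<Sum>i\<in>I. b i * k) \<le> (\<Sum>i\<in>I. b i * (1 - b i) / (1 + u * b i))" by (intro sum_mono)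
  moreover have "c \<tau> * k \<le> c \<tau>" using k1 t by (simp add: mult_left_le)
  moreover have "real m * (\<tau> * (1 - \<tau>) / (1 + u * \<tau>)) = real m * \<tau> * k" by (simp add: k_def)
  ultimately have "(c \<tau> + (\<Sum>i\<in>I. b i) + real m * \<tau>) * k \<le> W \<tau> u"
    by (simp add: wsum_def distrib_right sum_distrib_right)
  then show ?thesis by (simp add: total k_def)
qed

lemma wsum_pos:
  assumes "cap \<tau>" "u \<ge> 0"
  shows "W \<tau> u > 0"
proof -
  have "A * (1 - \<tau>) / (1 + u * \<tau>) > 0"
    using assms A3 lin_pos by (auto simp: cap_def)
  then show ?thesis using wsum_lower[OF assms] by linarith
qed

definition dL_u :: "real \<Rightarrow> real \<Rightarrow> real" where
  "dL_u \<tau> u = c \<tau> + (\<Sum>i\<in>I. b i / (1 + u * b i)) + real m * (\<tau> / (1 + u * \<tau>))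
    - ((\<Sum>i\<in>I. (b i)\<^sup>2 * (1 - b i) / (1 + u * b i)\<^sup>2) + real m * (\<tau>\<^sup>2 * (1 - \<tau>) / (1 + u * \<tau>)\<^sup>2)) / W \<tau> u"

lemma deriv_L_u:
  assumes "cap \<tau>" "u \<ge> 0"
  shows "(L \<tau> has_real_derivative dL_u \<tau> u) (at u)"
proof -
  have t: "0 \<le> \<tau>" "\<tau> < 1" and A0: "A > 0" using assms(1) A3 by (auto simp: cap_def)
  have p: "1 + u * \<tau> > 0" "\<And>i. i \<in> I \<Longrightarrow> 1 + u * b i > 0" using lin_pos t assms b0 by auto
  have w: "W \<tau> u > 0" by (rule wsum_pos[OF assms])
  have dW: "((\<lambda>u. W \<tau> u) has_real_derivative
     - ((\<Sum>i\<in>I. (b i)\<^sup>2 * (1 - b i) / (1 + u * b i)\<^sup>2) + real m * (\<tau>\<^sup>2 * (1 - \<tau>) / (1 + u * \<tau>)\<^sup>2))) (at u)"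
  proof -
    have *: "((\<lambda>u. x * (1 - x) / (1 + u * x)) has_real_derivative - (x\<^sup>2 * (1 - x) / (1 + u * x)\<^sup>2)) (at u)"
      if "1 + u * x > 0" for x :: real
      using that by (auto intro!: derivative_eq_intros simp: power2_eq_square)
    have "((\<lambda>u. \<Sum>i\<in>I. b i * (1 - b i) / (1 + u * b i)) has_real_derivative
        (\<Sum>i\<in>I. - ((b i)\<^sup>2 * (1 - b i) / (1 + u * b i)\<^sup>2))) (at u)"
      by (intro DERIV_sum * p)
    from DERIV_add[OF DERIV_add[OF DERIV_const[of "c \<tau>"] this] DERIV_cmult[OF *[OF p(1)], of "real m"]]
    show ?thesis unfolding wsum_def by (simp add: sum_negf)
  qed
  have "((\<lambda>u. ln (W \<tau> u / A)) has_real_derivative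
     - ((\<Sum>i\<in>I. (b i)\<^sup>2 * (1 - b i) / (1 + u * b i)\<^sup>2) + real m * (\<tau>\<^sup>2 * (1 - \<tau>) / (1 + u * \<tau>)\<^sup>2)) / W \<tau> u) (at u)"
    using w A0 by (auto intro!: derivative_eq_intros dW)
  moreover have "((\<lambda>u. (1 + u) * c \<tau>) has_real_derivative c \<tau>) (at u)"
    by (auto intro!: derivative_eq_intros)
  moreover have "((\<lambda>u. \<Sum>i\<in>I. ln (1 + u * b i) - ln (1 - b i)) has_real_derivative (\<Sum>i\<in>I. b i / (1 + u * b i))) (at u)"
    using p by (intro DERIV_sum) (auto intro!: derivative_eq_intros)
  moreover have "((\<lambda>u. real m * (ln (1 + u * \<tau>) - ln (1 - \<tau>))) has_real_derivative real m * (\<tau> / (1 + u * \<tau>))) (at u)"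
    using p(1) by (auto intro!: derivative_eq_intros)
  ultimately have "((\<lambda>u. (1 + u) * c \<tau> + (\<Sum>i\<in>I. ln (1 + u * b i) - ln (1 - b i)) + real m * (ln (1 + u * \<tau>) - ln (1 - \<tau>)) + ln (W \<tau> u / A))
    has_real_derivative c \<tau> + (\<Sum>i\<in>I. b i / (1 + u * b i)) + real m * (\<tau> / (1 + u * \<tau>))
     + - ((\<Sum>i\<in>I. (b i)\<^sup>2 * (1 - b i) / (1 + u * b i)\<^sup>2) + real m * (\<tau>\<^sup>2 * (1 - \<tau>) / (1 + u * \<tau>)\<^sup>2)) / W \<tau> u) (at u)"
    by (intro DERIV_add)
  moreover have "L \<tau> = (\<lambda>u. (1 + u) * c \<tau> + (\<Sum>i\<in>I. ln (1 + u * b i) - ln (1 - b i)) + real m * (ln (1 + u * \<tau>) - ln (1 - \<tau>)) + ln (W \<tau> u / A))"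
    by (rule ext) (simp add: logG_def)
  ultimately show ?thesis unfolding dL_u_def by (simp only: diff_conv_add_uminus minus_divide_left)
qed

lemma dL_u_lower:
  assumes "cap \<tau>" "u \<ge> 0"
  shows "(A - \<tau>) / (1 + u * \<tau>) \<le> dL_u \<tau> u"
proof -
  have t: "0 \<le> \<tau>" "\<tau> < 1" "c \<tau> \<ge> 0" and bt: "\<And>i. i \<in> I \<Longrightarrow> b i \<le> \<tau>"
    using assms(1) by (auto simp: cap_def)
  have p: "1 + u * \<tau> > 0" and pb: "\<And>i. i \<in> I \<Longrightarrow> 1 + u * b i > 0" using lin_pos t assms b0 by auto
  have w: "W \<tau> u > 0" by (rule wsum_pos[OF assms])
  have le: "1 + u * b i \<le> 1 + u * \<tau>" if "i \<in> I" for i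
    using bt[OF that] assms(2) by (simp add: mult_left_mono)
  have "(\<Sum>i\<in>I. b i / (1 + u * \<tau>)) \<le> (\<Sum>i\<in>I. b i / (1 + u * b i))"
    using le p pb b0 by (intro sum_mono divide_left_mono) auto
  moreover have "c \<tau> / (1 + u * \<tau>) \<le> c \<tau>"
    using t assms(2) p by (simp add: divide_le_eq mult_left_le algebra_simps)
  ultimately have 1: "A / (1 + u * \<tau>) \<le> c \<tau> + (\<Sum>i\<in>I. b i / (1 + u * b i)) + real m * (\<tau> / (1 + u * \<tau>))"
    by (subst total[of \<tau>, symmetric]) (simp add: add_divide_distrib sum_divide_distrib)
  have "(b i)\<^sup>2 * (1 - b i) / (1 + u * b i)\<^sup>2 \<le> \<tau> / (1 + u * \<tau>) * (b i * (1 - b i) / (1 + u * b i))" if "i \<in> I" for i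
  proof -
    have "b i / (1 + u * b i) \<le> \<tau> / (1 + u * \<tau>)"
      using p pb[OF that] bt[OF that] by (simp add: divide_simps algebra_simps)
    moreover have "b i * (1 - b i) / (1 + u * b i) \<ge> 0"
      using b0[OF that] bt[OF that] t pb[OF that] by auto
    ultimately have "b i / (1 + u * b i) * (b i * (1 - b i) / (1 + u * b i)) \<le> \<tau> / (1 + u * \<tau>) * (b i * (1 - b i) / (1 + u * b i))"
      by (rule mult_right_mono)
    then show ?thesis by (simp add: power2_eq_square mult_ac)
  qed
  then have "(\<Sum>i\<in>I. (b i)\<^sup>2 * (1 - b i) / (1 + u * b i)\<^sup>2) \<le> \<tau> / (1 + u * \<tau>) * (\<Sum>i\<in>I. b i * (1 - b i) / (1 + u * b i))"
    unfolding sum_distrib_left by (rule sum_mono)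
  moreover have "real m * (\<tau>\<^sup>2 * (1 - \<tau>) / (1 + u * \<tau>)\<^sup>2) = \<tau> / (1 + u * \<tau>) * (real m * (\<tau> * (1 - \<tau>) / (1 + u * \<tau>)))"
    by (simp add: power2_eq_square)
  moreover have "0 \<le> \<tau> / (1 + u * \<tau>) * c \<tau>" using t p by simp
  ultimately have "(\<Sum>i\<in>I. (b i)\<^sup>2 * (1 - b i) / (1 + u * b i)\<^sup>2) + real m * (\<tau>\<^sup>2 * (1 - \<tau>) / (1 + u * \<tau>)\<^sup>2) \<le> \<tau> / (1 + u * \<tau>) * W \<tau> u"
    unfolding wsum_def distrib_left by linarith
  then have "((\<Sum>i\<in>I. (b i)\<^sup>2 * (1 - b i) / (1 + u * b i)\<^sup>2) + real m * (\<tau>\<^sup>2 * (1 - \<tau>) / (1 + u * \<tau>)\<^sup>2)) / W \<tau> u \<le> \<tau> / (1 + u * \<tau>)"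
    using w by (simp add: divide_le_eq)
  with 1 show ?thesis unfolding dL_u_def by (simp add: diff_divide_distrib)
qed

text \<open>The derivative of \<open>L\<close> in one of the \<open>m\<close> copies of \<open>\<tau>\<close> while the lost mass is added to the slack.\<close>
definition dL_\<tau> :: "real \<Rightarrow> real \<Rightarrow> real" where
  "dL_\<tau> \<tau> u = \<tau> * (1 + u) / (1 + u * \<tau>) * (1 / (1 - \<tau>) - u - (2 + u * \<tau>) / ((1 + u * \<tau>) * W \<tau> u))"

lemma deriv_L_\<tau>:
  assumes "cap \<tau>" "u \<ge> 0"
  shows "((\<lambda>\<tau>. L \<tau> u) has_real_derivative real m * dL_\<tau> \<tau> u) (at \<tau>)"
proof -
  have t: "0 \<le> \<tau>" "\<tau> < 1" and A0: "A > 0" using assms(1) A3 by (auto simp: cap_def)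
  have p: "1 + u * \<tau> > 0" using lin_pos t assms by auto
  have w: "W \<tau> u > 0" by (rule wsum_pos[OF assms])
  define y where "y = 1 + u * \<tau>"
  have y: "y > 0" using p by (simp add: y_def)
  have dc: "((\<lambda>\<tau>. c \<tau>) has_real_derivative - real m) (at \<tau>)"
    unfolding slack_def by (auto intro!: derivative_eq_intros)
  have dW: "((\<lambda>\<tau>. W \<tau> u) has_real_derivative - (real m * (\<tau> * (1 + u) * (2 + u * \<tau>) / (1 + u * \<tau>)\<^sup>2))) (at \<tau>)"
  proof -
    have "((\<lambda>\<tau>. \<tau> * (1 - \<tau>) / (1 + u * \<tau>)) has_real_derivative (((1 - 2 * \<tau>) * (1 + u * \<tau>) - \<tau> * (1 - \<tau>) * u) / (1 + u * \<tau>)\<^sup>2)) (at \<tau>)"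
      using p by (auto intro!: derivative_eq_intros simp: power2_eq_square algebra_simps)
    from DERIV_add[OF DERIV_add[OF dc DERIV_const] DERIV_cmult[OF this, of "real m"]]
    have "((\<lambda>\<tau>. W \<tau> u) has_real_derivative (- real m + real m * (((1 - 2 * \<tau>) * (1 + u * \<tau>) - \<tau> * (1 - \<tau>) * u) / (1 + u * \<tau>)\<^sup>2))) (at \<tau>)"
      unfolding wsum_def by simp
    moreover have "- real m + real m * (((1 - 2 * \<tau>) * (1 + u * \<tau>) - \<tau> * (1 - \<tau>) * u) / (1 + u * \<tau>)\<^sup>2)
       = - (real m * (\<tau> * (1 + u) * (2 + u * \<tau>) / (1 + u * \<tau>)\<^sup>2))"
    proof -
      have "((1 - 2 * \<tau>) * (1 + u * \<tau>) - \<tau> * (1 - \<tau>) * u) = (1 + u * \<tau>)\<^sup>2 - \<tau> * (1 + u) * (2 + u * \<tau>)"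
        by algebra
      then show ?thesis using p by (simp add: diff_divide_distrib right_diff_distrib)
    qed
    ultimately show ?thesis by simp
  qed
  have "((\<lambda>\<tau>. ln (W \<tau> u / A)) has_real_derivative - (real m * (\<tau> * (1 + u) * (2 + u * \<tau>) / (1 + u * \<tau>)\<^sup>2)) / W \<tau> u) (at \<tau>)"
    using w A0 by (auto intro!: derivative_eq_intros dW simp: mult_ac)
  moreover have "((\<lambda>\<tau>. real m * (ln (1 + u * \<tau>) - ln (1 - \<tau>))) has_real_derivative real m * (u / (1 + u * \<tau>) + 1 / (1 - \<tau>))) (at \<tau>)"
    using p t by (auto intro!: derivative_eq_intros)
  ultimately have "((\<lambda>\<tau>. L \<tau> u) has_real_derivative
     (1 + u) * (- real m) + 0 + real m * (u / (1 + u * \<tau>) + 1 / (1 - \<tau>)) + - (real m * (\<tau> * (1 + u) * (2 + u * \<tau>) / (1 + u * \<tau>)\<^sup>2)) / W \<tau> u) (at \<tau>)"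
    unfolding logG_def by (intro DERIV_add DERIV_cmult[OF dc] DERIV_const)
  then have "((\<lambda>\<tau>. L \<tau> u) has_real_derivative
     (1 + u) * (- real m) + real m * (u / (1 + u * \<tau>) + 1 / (1 - \<tau>)) + - (real m * (\<tau> * (1 + u) * (2 + u * \<tau>) / (1 + u * \<tau>)\<^sup>2)) / W \<tau> u) (at \<tau>)"
    by simp
  moreover have "(1 + u) * (- real m) + real m * (u / (1 + u * \<tau>) + 1 / (1 - \<tau>)) + - (real m * (\<tau> * (1 + u) * (2 + u * \<tau>) / (1 + u * \<tau>)\<^sup>2)) / W \<tau> u = real m * dL_\<tau> \<tau> u"
  proof -
    have "- (1 + u) + u / (1 + u * \<tau>) + 1 / (1 - \<tau>) = \<tau> * (1 + u) / (1 + u * \<tau>) * (1 / (1 - \<tau>) - u)"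
      using p t by (simp add: field_simps)
    moreover have "\<tau> * (1 + u) / (1 + u * \<tau>) * ((2 + u * \<tau>) / ((1 + u * \<tau>) * W \<tau> u)) = (\<tau> * (1 + u) * (2 + u * \<tau>) / (1 + u * \<tau>)\<^sup>2) / W \<tau> u"
      by (simp add: power2_eq_square mult_ac)
    ultimately have "dL_\<tau> \<tau> u = - (1 + u) + u / (1 + u * \<tau>) + 1 / (1 - \<tau>) - (\<tau> * (1 + u) * (2 + u * \<tau>) / (1 + u * \<tau>)\<^sup>2) / W \<tau> u"
      unfolding dL_\<tau>_def right_diff_distrib by simp
    moreover have "(1 + u) * (- k) + k * (x + y) + - (k * z) / w = k * (- (1 + u) + x + y - z / w)" for k x y z w :: real
      by (simp add: algebra_simps)
    ultimately show ?thesis by simp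
  qed
  ultimately show ?thesis by simp
qed

text \<open>The right-hand side is negative for large \<open>u\<close> when \<open>\<tau> > 0\<close>, so the integrand is not monotone in \<open>\<tau>\<close> for each \<open>u\<close>
separately; only its integral is. Multiplied by the kernel \<open>exp (- L \<tau> u / 2) / (1 + u)\<close>, the left-hand side is a nonnegative
multiple of the derivative of \<open>v * exp (- L \<tau> (v\<^sup>2) / 2)\<close> with \<open>u = v\<^sup>2\<close>, so its integral is known. After the two bounds
\<open>wsum_lower\<close> and \<open>dL_u_lower\<close> the claim reduces to \<open>(A - 3) * (A - \<tau>) \<ge> 0\<close>; this is where the threshold
\<open>sqrt 3\<close> comes from.\<close>
lemma dL_\<tau>_lower:
  assumes "cap \<tau>" "u \<ge> 0"
  shows "\<tau> * (1 + u) * ((A - 2) / (A * (1 - \<tau>))) * (1 - u * dL_u \<tau> u) \<le> dL_\<tau> \<tau> u"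
proof -
  have t: "0 \<le> \<tau>" "\<tau> < 1" using assms(1) by (auto simp: cap_def)
  have p: "1 + u * \<tau> > 0" using lin_pos t assms by auto
  have w: "W \<tau> u > 0" by (rule wsum_pos[OF assms])
  have q: "A * (1 - \<tau>) > 0" using A3 t by simp
  have "A * (1 - \<tau>) \<le> (1 + u * \<tau>) * W \<tau> u"
    using wsum_lower[OF assms] p by (simp add: divide_le_eq mult.commute)
  then have "(2 + u * \<tau>) / ((1 + u * \<tau>) * W \<tau> u) \<le> (2 + u * \<tau>) / (A * (1 - \<tau>))"
    using q p t w assms(2) by (intro divide_left_mono) auto
  moreover have "(A - 2) * (1 - (A - 2 * \<tau>) * u) / (A * (1 - \<tau>)) \<le> 1 / (1 - \<tau>) - u - (2 + u * \<tau>) / (A * (1 - \<tau>))"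
  proof -
    \<comment> \<open>With \<open>wsum_lower\<close> inserted, the two sides of the claim differ by this nonnegative quantity over \<open>A * (1 - \<tau>)\<close>.\<close>
    have "0 \<le> u * ((A - 3) * (A - \<tau>))" using A3 t assms(2) by simp
    also have "u * ((A - 3) * (A - \<tau>)) = (A - u * (A * (1 - \<tau>)) - (2 + u * \<tau>)) - (A - 2) * (1 - (A - 2 * \<tau>) * u)"
      by algebra
    finally have "(A - 2) * (1 - (A - 2 * \<tau>) * u) / (A * (1 - \<tau>)) \<le> (A - u * (A * (1 - \<tau>)) - (2 + u * \<tau>)) / (A * (1 - \<tau>))"
      using q by (intro divide_right_mono) auto
    also have "\<dots> = 1 / (1 - \<tau>) - u - (2 + u * \<tau>) / (A * (1 - \<tau>))"
      using A3 t by (simp add: diff_divide_distrib)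
    finally show ?thesis .
  qed
  ultimately have bracket: "(A - 2) / (A * (1 - \<tau>)) * (1 - (A - 2 * \<tau>) * u) \<le> 1 / (1 - \<tau>) - u - (2 + u * \<tau>) / ((1 + u * \<tau>) * W \<tau> u)"
    by simp
  have "1 - u * dL_u \<tau> u \<le> 1 - u * ((A - \<tau>) / (1 + u * \<tau>))"
    using mult_left_mono[OF dL_u_lower[OF assms] assms(2)] by simp
  also have "\<dots> = (1 - (A - 2 * \<tau>) * u) / (1 + u * \<tau>)"
    using p by (simp add: field_simps)
  finally have "1 - u * dL_u \<tau> u \<le> (1 - (A - 2 * \<tau>) * u) / (1 + u * \<tau>)" .
  then have "\<tau> * (1 + u) * ((A - 2) / (A * (1 - \<tau>))) * (1 - u * dL_u \<tau> u)
     \<le> \<tau> * (1 + u) * ((A - 2) / (A * (1 - \<tau>))) * ((1 - (A - 2 * \<tau>) * u) / (1 + u * \<tau>))"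
    using A3 t assms(2) by (intro mult_left_mono) auto
  also have "\<dots> = \<tau> * (1 + u) / (1 + u * \<tau>) * ((A - 2) / (A * (1 - \<tau>)) * (1 - (A - 2 * \<tau>) * u))"
    by (simp add: mult_ac)
  also have "\<dots> \<le> dL_\<tau> \<tau> u"
    unfolding dL_\<tau>_def using t p assms(2) by (intro mult_left_mono[OF bracket]) auto
  finally show ?thesis .
qed

text \<open>Truncation at \<open>N\<close> keeps all integrals on a compact set, and it does no harm: the boundary term at \<open>N\<close> in the
next estimate has the favourable sign.\<close>
definition J :: "real \<Rightarrow> real \<Rightarrow> real" where
  "J N \<tau> = integral {0..N} (\<lambda>v. exp (- L \<tau> (v\<^sup>2) / 2) / (1 + v\<^sup>2))"

lemma cap_between:
  assumes "cap \<tau>\<^sub>1" "cap \<tau>\<^sub>2" "\<tau> \<in> {\<tau>\<^sub>1..\<tau>\<^sub>2}"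
  shows "cap \<tau>"
proof -
  have "real m * \<tau> \<le> real m * \<tau>\<^sub>2" using assms(3) by (intro mult_left_mono) auto
  then have "c \<tau>\<^sub>2 \<le> c \<tau>" by (simp add: slack_def)
  then show ?thesis using assms by (fastforce simp: cap_def)
qed

lemma continuous_kernel:
  assumes "\<And>\<tau>. \<tau> \<in> U \<Longrightarrow> cap \<tau>"
  shows "continuous_on (U \<times> X) (\<lambda>(\<tau>, v). exp (- L \<tau> (v\<^sup>2) / 2) / (1 + v\<^sup>2))"
    and "continuous_on (U \<times> X) (\<lambda>(\<tau>, v). - (real m * dL_\<tau> \<tau> (v\<^sup>2)) / 2 * (exp (- L \<tau> (v\<^sup>2) / 2) / (1 + v\<^sup>2)))"
proof -
  have nz: "1 + v\<^sup>2 \<noteq> 0" for v :: real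
    using add_pos_nonneg[OF zero_less_one, of "v\<^sup>2"] by simp
  have t: "1 - \<tau> \<noteq> 0" "W \<tau> (v\<^sup>2) \<noteq> 0" "1 + v\<^sup>2 * \<tau> \<noteq> 0" if "\<tau> \<in> U" for \<tau> v
    using assms[OF that] wsum_pos[of \<tau> "v\<^sup>2"] lin_pos[of \<tau> "v\<^sup>2"] by (auto simp: cap_def)
  have tb: "1 + v\<^sup>2 * b i \<noteq> 0" if "i \<in> I" for i v
    using b0[OF that] lin_pos[of "b i" "v\<^sup>2"] by auto
  have tb1: "1 - b i \<noteq> 0" if "i \<in> I" "\<tau> \<in> U" for i \<tau>
    using assms[OF that(2)] that by (auto simp: cap_def)
  have cW: "continuous_on (U \<times> X) (\<lambda>p. W (fst p) ((snd p)\<^sup>2))"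
    unfolding wsum_def slack_def
    by (intro continuous_intros ballI) (auto dest: t(3) tb)
  have cL: "continuous_on (U \<times> X) (\<lambda>p. L (fst p) ((snd p)\<^sup>2))"
    unfolding logG_def slack_def using A3
    by (intro continuous_intros cW ballI) (auto dest: t tb tb1)
  show K: "continuous_on (U \<times> X) (\<lambda>(\<tau>, v). exp (- L \<tau> (v\<^sup>2) / 2) / (1 + v\<^sup>2))"
    unfolding split_beta by (intro continuous_intros cL) (use nz in auto)
  have cD: "continuous_on (U \<times> X) (\<lambda>p. dL_\<tau> (fst p) ((snd p)\<^sup>2))"
    unfolding dL_\<tau>_def by (intro continuous_intros cW ballI) (auto dest: t)
  show "continuous_on (U \<times> X) (\<lambda>(\<tau>, v). - (real m * dL_\<tau> \<tau> (v\<^sup>2)) / 2 * (exp (- L \<tau> (v\<^sup>2) / 2) / (1 + v\<^sup>2)))"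
    unfolding split_beta by (intro continuous_intros cD K[unfolded split_beta]) auto
qed

text \<open>By \<open>dL_\<tau>_lower\<close> the integrand is at most a nonpositive multiple of the derivative of \<open>v * exp (- L \<tau> (v\<^sup>2) / 2)\<close>,
which vanishes at 0 and is nonnegative at \<open>N\<close>.\<close>
lemma kernel_\<tau>_derivative_integral_nonpos:
  assumes "cap \<tau>" "N \<ge> 0"
  shows "integral {0..N} (\<lambda>v. - (real m * dL_\<tau> \<tau> (v\<^sup>2)) / 2 * (exp (- L \<tau> (v\<^sup>2) / 2) / (1 + v\<^sup>2))) \<le> 0"
proof -
  have t: "0 \<le> \<tau>" "\<tau> < 1" using assms(1) by (auto simp: cap_def)
  define C where "C = real m / 2 * (\<tau> * ((A - 2) / (A * (1 - \<tau>))))"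
  have C: "C \<ge> 0" using t A3 by (simp add: C_def)
  have I0: "((\<lambda>v. exp (- L \<tau> (v\<^sup>2) / 2) * (1 - v\<^sup>2 * dL_u \<tau> (v\<^sup>2))) has_integral
     N * exp (- L \<tau> (N\<^sup>2) / 2) - 0 * exp (- L \<tau> (0\<^sup>2) / 2)) {0..N}"
  proof (rule fundamental_theorem_of_calculus[OF assms(2)])
    fix v :: real assume "v \<in> {0..N}"
    have "((\<lambda>v. L \<tau> (v\<^sup>2)) has_real_derivative dL_u \<tau> (v\<^sup>2) * (2 * v)) (at v)"
      by (rule DERIV_chain2[OF deriv_L_u[OF assms(1)]]) (auto intro!: derivative_eq_intros)
    then have "((\<lambda>v. v * exp (- L \<tau> (v\<^sup>2) / 2)) has_real_derivative exp (- L \<tau> (v\<^sup>2) / 2) * (1 - v\<^sup>2 * dL_u \<tau> (v\<^sup>2))) (at v)"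
      by (auto intro!: derivative_eq_intros simp: right_diff_distrib power2_eq_square)
    then show "((\<lambda>v. v * exp (- L \<tau> (v\<^sup>2) / 2)) has_vector_derivative exp (- L \<tau> (v\<^sup>2) / 2) * (1 - v\<^sup>2 * dL_u \<tau> (v\<^sup>2))) (at v within {0..N})"
      by (simp add: has_real_derivative_iff_has_vector_derivative has_vector_derivative_at_within)
  qed
  have I1: "((\<lambda>v. - C * (exp (- L \<tau> (v\<^sup>2) / 2) * (1 - v\<^sup>2 * dL_u \<tau> (v\<^sup>2)))) has_integral
     - C * (N * exp (- L \<tau> (N\<^sup>2) / 2))) {0..N}"
    using has_integral_mult_right[OF I0, of "- C"] by (simp only: mult_zero_left diff_zero)
  have "continuous_on {0..N} (\<lambda>v. - (real m * dL_\<tau> \<tau> (v\<^sup>2)) / 2 * (exp (- L \<tau> (v\<^sup>2) / 2) / (1 + v\<^sup>2)))"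
  proof -
    have "continuous_on {0..N} ((\<lambda>(\<tau>, v). - (real m * dL_\<tau> \<tau> (v\<^sup>2)) / 2 * (exp (- L \<tau> (v\<^sup>2) / 2) / (1 + v\<^sup>2))) \<circ> Pair \<tau>)"
      using assms by (intro continuous_on_compose continuous_intros
        continuous_on_subset[OF continuous_kernel(2)[of "{\<tau>}" "{0..N}"]]) auto
    then show ?thesis by (simp add: comp_def)
  qed
  then have I2: "(\<lambda>v. - (real m * dL_\<tau> \<tau> (v\<^sup>2)) / 2 * (exp (- L \<tau> (v\<^sup>2) / 2) / (1 + v\<^sup>2))) integrable_on {0..N}"
    by (rule integrable_continuous_real)
  have "integral {0..N} (\<lambda>v. - (real m * dL_\<tau> \<tau> (v\<^sup>2)) / 2 * (exp (- L \<tau> (v\<^sup>2) / 2) / (1 + v\<^sup>2)))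
     \<le> - C * (N * exp (- L \<tau> (N\<^sup>2) / 2))"
  proof (rule has_integral_le[OF integrable_integral[OF I2] I1])
    fix v :: real
    have p: "1 + v\<^sup>2 > 0" by (simp add: add_pos_nonneg)
    have "real m / 2 * (exp (- L \<tau> (v\<^sup>2) / 2) / (1 + v\<^sup>2)) * (\<tau> * (1 + v\<^sup>2) * ((A - 2) / (A * (1 - \<tau>))) * (1 - v\<^sup>2 * dL_u \<tau> (v\<^sup>2)))
      \<le> real m / 2 * (exp (- L \<tau> (v\<^sup>2) / 2) / (1 + v\<^sup>2)) * dL_\<tau> \<tau> (v\<^sup>2)"
      using p by (intro mult_left_mono dL_\<tau>_lower assms) auto
    moreover have "real m / 2 * (exp (- L \<tau> (v\<^sup>2) / 2) / (1 + v\<^sup>2)) * (\<tau> * (1 + v\<^sup>2) * ((A - 2) / (A * (1 - \<tau>))) * (1 - v\<^sup>2 * dL_u \<tau> (v\<^sup>2)))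
      = C * (exp (- L \<tau> (v\<^sup>2) / 2) * (1 - v\<^sup>2 * dL_u \<tau> (v\<^sup>2)))"
    proof -
      have *: "k * (E / r) * (x * r * K * y) = k * (x * K) * (E * y)" if "r \<noteq> 0" for k E r x K y :: real
        using that by simp
      have "1 + v\<^sup>2 \<noteq> 0" using p by simp
      then show ?thesis unfolding C_def by (rule *)
    qed
    ultimately show "- (real m * dL_\<tau> \<tau> (v\<^sup>2)) / 2 * (exp (- L \<tau> (v\<^sup>2) / 2) / (1 + v\<^sup>2))
      \<le> - C * (exp (- L \<tau> (v\<^sup>2) / 2) * (1 - v\<^sup>2 * dL_u \<tau> (v\<^sup>2)))"
      by (simp add: mult_ac)
  qed
  also have "\<dots> \<le> 0" using C assms(2) by simp
  finally show ?thesis .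
qed

lemma J_antimono:
  assumes cap: "cap \<tau>\<^sub>1" "cap \<tau>\<^sub>2" and le: "\<tau>\<^sub>1 \<le> \<tau>\<^sub>2" and N: "N \<ge> 0"
  shows "J N \<tau>\<^sub>2 \<le> J N \<tau>\<^sub>1"
proof -
  let ?U = "{\<tau>\<^sub>1..\<tau>\<^sub>2}"
  let ?g = "\<lambda>\<tau> v. exp (- L \<tau> (v\<^sup>2) / 2) / (1 + v\<^sup>2)"
  let ?g' = "\<lambda>\<tau> v. - (real m * dL_\<tau> \<tau> (v\<^sup>2)) / 2 * (exp (- L \<tau> (v\<^sup>2) / 2) / (1 + v\<^sup>2))"
  have capU: "cap \<tau>" if "\<tau> \<in> ?U" for \<tau> using cap_between[OF cap that] .
  have leibniz: "((\<lambda>\<tau>. integral (cbox 0 N) (?g \<tau>)) has_real_derivative integral (cbox 0 N) (?g' \<tau>)) (at \<tau> within ?U)"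
    if "\<tau> \<in> ?U" for \<tau>
  proof (rule leibniz_rule_field_derivative[OF _ _ _ that])
    fix \<tau> v :: real assume "\<tau> \<in> ?U" "v \<in> cbox 0 N"
    have "((\<lambda>\<tau>. L \<tau> (v\<^sup>2)) has_real_derivative real m * dL_\<tau> \<tau> (v\<^sup>2)) (at \<tau>)"
      using capU[OF \<open>\<tau> \<in> ?U\<close>] by (intro deriv_L_\<tau>) auto
    moreover have "1 + v\<^sup>2 \<noteq> 0"
      using add_pos_nonneg[OF zero_less_one, of "v\<^sup>2"] by simp
    ultimately have "((\<lambda>\<tau>. ?g \<tau> v) has_real_derivative ?g' \<tau> v) (at \<tau>)"
      by (auto intro!: derivative_eq_intros)
    then show "((\<lambda>\<tau>. ?g \<tau> v) has_real_derivative ?g' \<tau> v) (at \<tau> within ?U)"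
      by (rule has_field_derivative_at_within)
  next
    fix \<tau> assume "\<tau> \<in> ?U"
    then have "continuous_on (cbox 0 N) ((\<lambda>(\<tau>, v). ?g \<tau> v) \<circ> Pair \<tau>)"
      using capU by (intro continuous_on_compose continuous_intros
        continuous_on_subset[OF continuous_kernel(1)[of "{\<tau>}" "cbox 0 N"]]) auto
    then show "?g \<tau> integrable_on cbox 0 N"
      by (intro integrable_continuous) (simp add: comp_def)
  next
    show "continuous_on (?U \<times> cbox 0 N) (\<lambda>(\<tau>, v). ?g' \<tau> v)"
      using continuous_kernel(2)[of ?U] capU by blast
  qed auto
  have deriv: "(J N has_real_derivative integral {0..N} (?g' \<tau>)) (at \<tau> within ?U)" if "\<tau> \<in> ?U" for \<tau>
    using leibniz[OF that] by (simp add: J_def[abs_def])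
  show ?thesis
  proof (rule DERIV_nonpos_imp_decreasing_open[OF le])
    fix \<tau> assume *: "\<tau>\<^sub>1 < \<tau>" "\<tau> < \<tau>\<^sub>2"
    then have "(J N has_real_derivative integral {0..N} (?g' \<tau>)) (at \<tau>)"
      using deriv[of \<tau>] at_within_Icc_at[of \<tau>\<^sub>1 \<tau> \<tau>\<^sub>2] by simp
    moreover have "integral {0..N} (?g' \<tau>) \<le> 0"
      using capU * N by (intro kernel_\<tau>_derivative_integral_nonpos) auto
    ultimately show "\<exists>y. (J N has_real_derivative y) (at \<tau>) \<and> y \<le> 0" by blast
  next
    show "continuous_on ?U (J N)"
      using deriv by (intro DERIV_continuous_on) auto
  qed
qed

end

text \<open>Lower \<open>\<tau>\<close> until it meets the largest remaining weight, count this weight as a further copy of \<open>\<tau>\<close>, and repeat;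
when no weight is left, lower \<open>\<tau>\<close> to 0. The integral does not decrease in any step.\<close>
lemma capped_integral_le:
  fixes b :: "'i \<Rightarrow> real"
  assumes "finite I" "\<And>i. i \<in> I \<Longrightarrow> 0 \<le> b i" "\<And>i. i \<in> I \<Longrightarrow> b i \<le> \<tau>" "0 \<le> \<tau>" "\<tau> < 1"
    "A \<ge> 3" "slack I b m A \<tau> \<ge> 0" "N \<ge> 0"
  shows "integral {0..N} (\<lambda>v. exp (- logG I b m A \<tau> (v\<^sup>2) / 2) / (1 + v\<^sup>2))
     \<le> integral {0..N} (\<lambda>v. exp (- ((1 + v\<^sup>2) * A) / 2) / (1 + v\<^sup>2))"
  using assms
proof (induction "card I" arbitrary: I m \<tau>)
  case 0
  then have I: "I = {}" by simp
  interpret capped_weights I b m A using 0 by unfold_locales auto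
  have "J N \<tau> \<le> J N 0"
    using 0 unfolding I by (intro capped_weights.J_antimono[of "{}" b A m]) (auto simp: capped_weights.cap_def capped_weights_def slack_def)
  also have "J N 0 = integral {0..N} (\<lambda>v. exp (- ((1 + v\<^sup>2) * A) / 2) / (1 + v\<^sup>2))"
    using \<open>A \<ge> 3\<close> unfolding J_def by (simp add: logG_def wsum_def slack_def I)
  finally show ?case by (simp add: J_def)
next
  case (Suc n)
  interpret capped_weights I b m A using Suc.prems by unfold_locales auto
  have ne: "I \<noteq> {}" using Suc.hyps(2) by auto
  define \<beta> where "\<beta> = Max (b ` I)"
  have "\<beta> \<in> b ` I" unfolding \<beta>_def using fin ne by (intro Max_in) auto
  then obtain k where k: "k \<in> I" "b k = \<beta>" by auto
  have le: "b i \<le> \<beta>" if "i \<in> I" for i using fin that by (simp add: \<beta>_def)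
  have \<beta>: "0 \<le> \<beta>" "\<beta> \<le> \<tau>" using k Suc.prems by auto
  have "real m * \<beta> \<le> real m * \<tau>" using \<beta> by (intro mult_left_mono) auto
  then have c\<beta>: "c \<beta> \<ge> 0" using Suc.prems(7) by (simp add: slack_def)
  have "J N \<tau> \<le> J N \<beta>"
    using Suc.prems c\<beta> \<beta> le by (intro J_antimono) (auto simp: cap_def)
  also have "J N \<beta> = integral {0..N} (\<lambda>v. exp (- logG (I - {k}) b (Suc m) A \<beta> (v\<^sup>2) / 2) / (1 + v\<^sup>2))"
  proof -
    have "L \<beta> u = logG (I - {k}) b (Suc m) A \<beta> u" for u
    proof -
      have "c \<beta> = slack (I - {k}) b (Suc m) A \<beta>"
        using sum.remove[OF fin k(1), of b] k(2) by (simp add: slack_def distrib_right)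
      moreover from this have "W \<beta> u = wsum (I - {k}) b (Suc m) A \<beta> u"
        using sum.remove[OF fin k(1), of "\<lambda>i. b i * (1 - b i) / (1 + u * b i)"] k(2)
        by (simp add: wsum_def distrib_right add_divide_distrib)
      ultimately show ?thesis
        using sum.remove[OF fin k(1), of "\<lambda>i. ln (1 + u * b i) - ln (1 - b i)"] k(2)
        by (simp add: logG_def distrib_right)
    qed
    then show ?thesis by (simp add: J_def)
  qed
  also have "\<dots> \<le> integral {0..N} (\<lambda>v. exp (- ((1 + v\<^sup>2) * A) / 2) / (1 + v\<^sup>2))"
  proof (rule Suc.hyps(1))
    show "n = card (I - {k})" using Suc.hyps(2) k fin by simp
    show "slack (I - {k}) b (Suc m) A \<beta> \<ge> 0"
      using c\<beta> k sum.remove[OF fin k(1), of b] by (simp add: slack_def algebra_simps)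
  qed (use Suc.prems \<beta> le in auto)
  finally show ?case by (simp add: J_def)
qed

section \<open>The level 1\<close>

lemma one_plus_sum_le_prod:
  fixes x :: "'i \<Rightarrow> real"
  assumes "finite I" "\<And>i. i \<in> I \<Longrightarrow> 0 \<le> x i"
  shows "1 + (\<Sum>i\<in>I. x i) \<le> (\<Prod>i\<in>I. 1 + x i)"
  using assms
proof (induction I)
  case (insert k I)
  have "0 \<le> (\<Sum>i\<in>I. x i)" using insert.prems by (intro sum_nonneg) auto
  then have "1 + (\<Sum>i\<in>insert k I. x i) \<le> (1 + x k) * (1 + (\<Sum>i\<in>I. x i))"
    using insert by (simp add: algebra_simps)
  also have "\<dots> \<le> (1 + x k) * (\<Prod>i\<in>I. 1 + x i)"
    using insert by (intro mult_left_mono) auto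
  finally show ?case using insert by simp
qed simp

text \<open>When the weights sum to 1, two weights \<open>1 / 2\<close> give \<open>2 + u\<close> and are extremal pointwise in \<open>u\<close>. Expanding the product over
\<open>j \<noteq> i\<close> to first order in \<open>x j = b j / (1 - b j)\<close> already suffices, because
\<open>\<Sum>i\<in>I. b i * (X - x i) = \<Sum>i\<in>I. x i * (1 - b i) = 1\<close>.\<close>
lemma unit_weights_bound:
  fixes b :: "'i \<Rightarrow> real"
  assumes I: "finite I" and b: "\<And>i. i \<in> I \<Longrightarrow> 0 \<le> b i" "\<And>i. i \<in> I \<Longrightarrow> b i < 1"
    and sum1: "(\<Sum>i\<in>I. b i) = 1" and u: "u \<ge> 0"
  shows "2 + u \<le> (\<Prod>i\<in>I. (1 + u * b i) / (1 - b i)) * (\<Sum>i\<in>I. b i * (1 - b i) / (1 + u * b i))"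
proof -
  define x where "x i = b i / (1 - b i)" for i
  define X where "X = (\<Sum>i\<in>I. x i)"
  have x0: "0 \<le> x i" if "i \<in> I" for i using b that by (simp add: x_def less_imp_le)
  have fac: "(1 + u * b i) / (1 - b i) = 1 + (1 + u) * x i" if "i \<in> I" for i
    using b(2)[OF that] by (simp add: x_def field_simps)
  have fpos: "1 + u * b i > 0" if "i \<in> I" for i using b(1)[OF that] u by (simp add: add_pos_nonneg)
  have summand: "b i * (1 + (1 + u) * (X - x i)) \<le> (\<Prod>j\<in>I. (1 + u * b j) / (1 - b j)) * (b i * (1 - b i) / (1 + u * b i))"
    if i: "i \<in> I" for i
  proof -
    have "1 + (1 + u) * (X - x i) = 1 + (\<Sum>j\<in>I-{i}. (1 + u) * x j)"
      using sum.remove[OF I i, of x] by (simp add: X_def sum_distrib_left[symmetric])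
    also have "\<dots> \<le> (\<Prod>j\<in>I-{i}. 1 + (1 + u) * x j)"
      using I x0 u by (intro one_plus_sum_le_prod) auto
    also have "\<dots> = (\<Prod>j\<in>I-{i}. (1 + u * b j) / (1 - b j))"
      using fac by (intro prod.cong) auto
    also have "\<dots> = (\<Prod>j\<in>I. (1 + u * b j) / (1 - b j)) * ((1 - b i) / (1 + u * b i))"
      using fpos[OF i] b(2)[OF i] prod.remove[OF I i, of "\<lambda>j. (1 + u * b j) / (1 - b j)"] by simp
    finally have "1 + (1 + u) * (X - x i) \<le> (\<Prod>j\<in>I. (1 + u * b j) / (1 - b j)) * ((1 - b i) / (1 + u * b i))" .
    from mult_left_mono[OF this b(1)[OF i]] show ?thesis by (simp add: mult_ac)
  qed
  have "(\<Sum>i\<in>I. b i * (1 + (1 + u) * (X - x i))) = (\<Sum>i\<in>I. b i) + (1 + u) * (X * (\<Sum>i\<in>I. b i) - (\<Sum>i\<in>I. b i * x i))"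
    by (simp add: algebra_simps sum.distrib sum_subtractf sum_distrib_left)
  also have "X * (\<Sum>i\<in>I. b i) - (\<Sum>i\<in>I. b i * x i) = (\<Sum>i\<in>I. x i * (1 - b i))"
    by (simp add: sum1 X_def algebra_simps sum_subtractf)
  also have "\<dots> = (\<Sum>i\<in>I. b i)"
  proof (intro sum.cong refl)
    fix i assume "i \<in> I"
    then show "x i * (1 - b i) = b i" using b(2)[of i] by (simp add: x_def)
  qed
  finally have "2 + u = (\<Sum>i\<in>I. b i * (1 + (1 + u) * (X - x i)))"
    by (simp add: sum1)
  also have "\<dots> \<le> (\<Sum>i\<in>I. (\<Prod>j\<in>I. (1 + u * b j) / (1 - b j)) * (b i * (1 - b i) / (1 + u * b i)))"
    by (intro sum_mono summand)
  finally show ?thesis by (simp add: sum_distrib_left)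
qed

lemma half_integral:
  "(\<integral>\<^sup>+v. ennreal (2 / pi / ((1 + v\<^sup>2) * sqrt (2 + v\<^sup>2))) * indicator {0..} v \<partial>lborel) = ennreal (1 / 2)"
proof -
  have lim: "((\<lambda>v::real. v / sqrt (2 + v\<^sup>2)) \<longlongrightarrow> 1) at_top" by real_asymp
  have lim': "((\<lambda>v::real. 2 / pi * arctan (v / sqrt (2 + v\<^sup>2))) \<longlongrightarrow> 2 / pi * arctan 1) at_top"
    by (intro tendsto_intros lim)
  have deriv: "((\<lambda>v. 2 / pi * arctan (v / sqrt (2 + v\<^sup>2))) has_real_derivative 2 / pi / ((1 + v\<^sup>2) * sqrt (2 + v\<^sup>2))) (at v)" for v :: real
  proof -
    define r where "r = sqrt (2 + v\<^sup>2)"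
    have r: "r > 0" "r\<^sup>2 = 2 + v\<^sup>2" "2 + v\<^sup>2 > 0" by (auto simp: r_def add_pos_nonneg)
    have d: "((\<lambda>v. v / sqrt (2 + v\<^sup>2)) has_real_derivative 2 / r ^ 3) (at v)"
    proof -
      have "((\<lambda>v. v / sqrt (2 + v\<^sup>2)) has_real_derivative (1 * r - v * (inverse r / 2 * (2 * v))) / (r * r)) (at v)"
        unfolding r_def using r by (auto intro!: derivative_eq_intros)
      also have "(1 * r - v * (inverse r / 2 * (2 * v))) / (r * r) = (r\<^sup>2 - v\<^sup>2) / r ^ 3"
        using r(1) by (simp add: field_simps power2_eq_square power3_eq_cube)
      finally show ?thesis by (simp add: r)
    qed
    have "((\<lambda>v. 2 / pi * arctan (v / sqrt (2 + v\<^sup>2))) has_real_derivative 2 / pi * (inverse (1 + (v / r)\<^sup>2) * (2 / r ^ 3))) (at v)"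
      unfolding r_def by (intro DERIV_cmult DERIV_chain2[OF DERIV_arctan] d[unfolded r_def])
    also have "inverse (1 + (v / r)\<^sup>2) * (2 / r ^ 3) = 1 / ((1 + v\<^sup>2) * r)"
    proof -
      have "1 + (v / r)\<^sup>2 = 2 * (1 + v\<^sup>2) / r\<^sup>2" using r by (simp add: power_divide field_simps)
      moreover have "1 + v\<^sup>2 > 0" by (simp add: add_pos_nonneg)
      ultimately show ?thesis using r(1) by (simp add: divide_simps) (simp add: power2_eq_square power3_eq_cube algebra_simps)
    qed
    finally show ?thesis by (simp add: r_def)
  qed
  have "(\<integral>\<^sup>+v. ennreal (2 / pi / ((1 + v\<^sup>2) * sqrt (2 + v\<^sup>2))) * indicator {0..} v \<partial>lborel)
     = ennreal (2 / pi * arctan 1 - 2 / pi * arctan (0 / sqrt (2 + 0\<^sup>2)))"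
    by (rule nn_integral_FTC_atLeast[OF _ deriv _ lim']) auto
  then show ?thesis by (simp add: arctan_one)
qed

context balanced_scales
begin

lemma cone_probability_le_half:
  assumes "A = 1"
  shows "emeasure (gauss_prod I) {z \<in> space (gauss_prod I). A * V2 z < (S z)\<^sup>2} \<le> ennreal (1 / 2)"
  unfolding cone_probability half_integral[symmetric]
proof (intro nn_integral_mono mult_right_mono ennreal_leI)
  fix v :: real
  have "2 + v\<^sup>2 \<le> G (v\<^sup>2)"
    unfolding G_def using unit_weights_bound[OF fin b_bounds _ zero_le_power2] sum_b assms by simp
  then show "2 / pi / ((1 + v\<^sup>2) * sqrt (G (v\<^sup>2))) \<le> 2 / pi / ((1 + v\<^sup>2) * sqrt (2 + v\<^sup>2))"
    by (intro divide_left_mono mult_left_mono mult_pos_pos real_sqrt_le_mono)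
       (auto simp: add_pos_nonneg intro: less_le_trans[rotated])
qed simp

end

lemma cone_probability_two_equal:
  fixes I :: "'i set"
  assumes I: "finite I" "j \<in> I" "k \<in> I" "j \<noteq> k"
  defines "\<sigma> \<equiv> \<lambda>i. if i = j \<or> i = k then 1 else (0::real)"
  shows "emeasure (gauss_prod I) {z \<in> space (gauss_prod I). (\<Sum>i\<in>I. (\<sigma> i)\<^sup>2 * (z i)\<^sup>2) < (\<Sum>i\<in>I. \<sigma> i * z i)\<^sup>2} = ennreal (1 / 2)"
proof -
  have sum2: "(\<Sum>i\<in>I. f i) = f j + f k" if "\<And>i. i \<noteq> j \<Longrightarrow> i \<noteq> k \<Longrightarrow> f i = 0" for f :: "'i \<Rightarrow> real"
  proof -
    have "(\<Sum>i\<in>I. f i) = (\<Sum>i\<in>{j, k}. f i)" using I that by (intro sum.mono_neutral_right) auto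
    then show ?thesis using I by simp
  qed
  have prod2: "(\<Prod>i\<in>I. f i) = f j * f k" if "\<And>i. i \<noteq> j \<Longrightarrow> i \<noteq> k \<Longrightarrow> f i = 1" for f :: "'i \<Rightarrow> real"
  proof -
    have "(\<Prod>i\<in>I. f i) = (\<Prod>i\<in>{j, k}. f i)" using I that by (intro prod.mono_neutral_right) auto
    then show ?thesis using I by simp
  qed
  interpret balanced_scales I \<sigma> 1
    by unfold_locales (use I in \<open>auto simp: sum2 \<sigma>_def\<close>)
  have "G u = 2 + u" if "u \<ge> 0" for u
  proof -
    have b: "b i = (if i = j \<or> i = k then 1 / 2 else 0)" for i unfolding b_def by (simp add: \<sigma>_def)
    have "(\<Prod>i\<in>I. (1 + u * b i) / (1 - b i)) = (2 + u)\<^sup>2"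
      by (subst prod2) (auto simp: b field_simps power2_eq_square)
    moreover have "(\<Sum>i\<in>I. b i * (1 - b i) / (1 + u * b i)) = 1 / (2 + u)"
      using that by (subst sum2) (auto simp: b field_simps)
    ultimately show ?thesis using that by (simp add: G_def power2_eq_square)
  qed
  then show ?thesis using cone_probability half_integral by (simp add: S_def V2_def)
qed

section \<open>Values of the normal distribution function\<close>

lemma nn_integral_interval_eq_integral:
  fixes f :: "real \<Rightarrow> real"
  assumes f: "continuous_on {a..b} f" and nn: "\<And>x. x \<in> {a..b} \<Longrightarrow> 0 \<le> f x"
  shows "(\<integral>\<^sup>+x. ennreal (f x) * indicator {a..b} x \<partial>lborel) = ennreal (integral {a..b} f)"
proof -
  have si: "set_integrable lborel {a..b} f"
    by (rule borel_integrable_atLeastAtMost'[OF f])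
  have "(\<integral>\<^sup>+x. ennreal (f x) * indicator {a..b} x \<partial>lborel) = (\<integral>\<^sup>+x. ennreal (indicator {a..b} x *\<^sub>R f x) \<partial>lborel)"
    by (intro nn_integral_cong) (simp add: indicator_def)
  also have "\<dots> = ennreal (LINT x:{a..b}|lborel. f x)"
    using si nn unfolding set_integrable_def set_lebesgue_integral_def
    by (intro nn_integral_eq_integral) (auto simp: indicator_def)
  also have "(LINT x:{a..b}|lborel. f x) = integral {a..b} f"
    using set_borel_integral_eq_integral(2)[OF si] .
  finally show ?thesis .
qed

lemma std_normal_cdf_two_sided:
  assumes "x \<ge> 0"
  shows "measure std_normal_distribution {y. x\<^sup>2 < y\<^sup>2} = 2 * (1 - std_normal_cdf x)"
proof -
  interpret real_distribution std_normal_distribution by (rule real_dist_normal_dist)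
  have "{x<..} = UNIV - {..x}" by auto
  then have "measure std_normal_distribution {x<..} = 1 - std_normal_cdf x"
    using prob_compl[of "{..x}"] by (simp add: cdf_def)
  moreover have "measure std_normal_distribution {y. x\<^sup>2 < y\<^sup>2} = 2 * measure std_normal_distribution {x<..}"
    using std_normal_two_sided[of "x\<^sup>2"] assms by (simp add: measure_def enn2real_mult)
  ultimately show ?thesis by simp
qed

lemma std_normal_cdf_eq_integral:
  assumes "x \<ge> 0"
  shows "std_normal_cdf x = 1 / 2 + integral {0..x} std_normal_density"
proof -
  interpret real_distribution std_normal_distribution by (rule real_dist_normal_dist)
  have null: "measure std_normal_distribution {0} = 0"
    by (simp add: measure_def emeasure_density cong: nn_integral_cong_AE)
  have "{y::real. 0 < y\<^sup>2} = UNIV - {0}" by auto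
  then have "measure std_normal_distribution {y. (0::real)\<^sup>2 < y\<^sup>2} = 1"
    using prob_compl[of "{0}"] null by simp
  then have half: "std_normal_cdf 0 = 1 / 2" using std_normal_cdf_two_sided[of 0] by simp
  have "{..x} = {..0} \<union> {0<..x}" using assms by auto
  then have "std_normal_cdf x = std_normal_cdf 0 + measure std_normal_distribution {0<..x}"
    unfolding cdf_def by (subst finite_measure_Union[symmetric]) auto
  moreover have "measure std_normal_distribution {0..x} = measure std_normal_distribution {0} + measure std_normal_distribution {0<..x}"
  proof -
    have "{0..x} = {0} \<union> {0<..x}" using assms by auto
    then show ?thesis by (subst finite_measure_Union[symmetric]) auto
  qed
  moreover have "measure std_normal_distribution {0..x} = integral {0..x} std_normal_density"
  proof -
    have "emeasure std_normal_distribution {0..x} = ennreal (integral {0..x} std_normal_density)"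
      using nn_integral_interval_eq_integral[of 0 x std_normal_density]
      by (simp add: emeasure_density normal_density_def continuous_intros)
    moreover have "integral {0..x} std_normal_density \<ge> 0"
      by (rule integral_nonneg) (auto simp: normal_density_def intro!: integrable_continuous_real continuous_intros)
    ultimately show ?thesis by (simp add: measure_def)
  qed
  ultimately show ?thesis using half null by simp
qed

text \<open>The truncation orders 8 and 9 make the error in the distribution function at \<open>sqrt 3\<close> smaller than the distance of about
\<open>0.00013\<close> between its value and the upper limit \<open>0.9585\<close>.\<close>
lemma exp_minus_alternating:
  fixes s :: real
  assumes "s \<ge> 0"
  shows "(\<Sum>k<8. (- s) ^ k / fact k) \<le> exp (- s)" "exp (- s) \<le> (\<Sum>k<9. (- s) ^ k / fact k)"
proof -
  obtain t where t: "exp (- s) = (\<Sum>k<8. (- s) ^ k / fact k) + exp t / fact 8 * (- s) ^ 8"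
    using Maclaurin_exp_le[of "- s" 8] by auto
  then show "(\<Sum>k<8. (- s) ^ k / fact k) \<le> exp (- s)" by simp
  obtain t where t: "exp (- s) = (\<Sum>k<9. (- s) ^ k / fact k) + exp t / fact 9 * (- s) ^ 9"
    using Maclaurin_exp_le[of "- s" 9] by auto
  have "exp t / fact 9 * (- s) ^ 9 \<le> 0" using assms by (simp add: mult_nonneg_nonpos)
  with t show "exp (- s) \<le> (\<Sum>k<9. (- s) ^ k / fact k)" by simp
qed

lemma has_integral_exp_series:
  assumes "x \<ge> 0"
  shows "((\<lambda>y. \<Sum>k<n. (- (y\<^sup>2 / 2)) ^ k / fact k) has_integral
    (\<Sum>k<n. (- 1 / 2) ^ k / fact k * (x * (x\<^sup>2) ^ k / (2 * real k + 1)))) {0..x}"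
proof (intro has_integral_sum finite_lessThan)
  fix k
  have "((\<lambda>y. y ^ (2 * k)) has_integral (x ^ Suc (2 * k) / Suc (2 * k) - 0 ^ Suc (2 * k) / Suc (2 * k))) {0..x}"
    using assms by (intro fundamental_theorem_of_calculus)
      (auto intro!: derivative_eq_intros simp: has_real_derivative_iff_has_vector_derivative[symmetric] simp del: power_Suc)
  from has_integral_mult_right[OF this, of "(- 1 / 2) ^ k / fact k"]
  have "((\<lambda>y. (- 1 / 2) ^ k / fact k * y ^ (2 * k)) has_integral (- 1 / 2) ^ k / fact k * (x * (x\<^sup>2) ^ k / (2 * real k + 1))) {0..x}"
    by (simp add: power_mult add.commute)
  moreover have "(- 1 / 2) ^ k / fact k * y ^ (2 * k) = (- (y\<^sup>2 / 2)) ^ k / fact k" for y :: real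
    by (simp add: power_mult power_mult_distrib[symmetric] power_divide)
  ultimately show "((\<lambda>y. (- (y\<^sup>2 / 2)) ^ k / fact k) has_integral (- 1 / 2) ^ k / fact k * (x * (x\<^sup>2) ^ k / (2 * real k + 1))) {0..x}"
    by simp
qed

lemma std_normal_cdf_sqrt3: "\<bar>std_normal_cdf (sqrt 3) - 0.958\<bar> < 0.0005"
proof -
  define E where "E = integral {0..sqrt 3} (\<lambda>y::real. exp (- (y\<^sup>2 / 2)))"
  have int: "(\<lambda>y::real. exp (- (y\<^sup>2 / 2))) integrable_on {0..sqrt 3}"
    by (intro integrable_continuous_real continuous_intros) auto
  have s: "(sqrt 3)\<^sup>2 = (3::real)" "sqrt 3 \<ge> (0::real)" by auto
  have lo: "sqrt 3 * 0.6633 \<le> E"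
  proof -
    have "(\<Sum>k<8. (- 1 / 2) ^ k / fact k * (sqrt 3 * 3 ^ k / (2 * real k + 1))) \<le> E"
      unfolding E_def using has_integral_exp_series[OF s(2), of 8] exp_minus_alternating(1) s(1)
      by (intro has_integral_le[OF _ integrable_integral[OF int]]) auto
    moreover have "(\<Sum>k<8. (- 1 / 2) ^ k / fact k * (sqrt 3 * 3 ^ k / (2 * real k + 1))) = sqrt 3 * (\<Sum>k<8. (- 1 / 2) ^ k / fact k * (3 ^ k / (2 * real k + 1)))"
      by (simp add: sum_distrib_left mult_ac)
    ultimately have le: "sqrt 3 * (\<Sum>k<8. (- 1 / 2) ^ k / fact k * (3 ^ k / (2 * real k + 1))) \<le> E"
      by simp
    have "0.6633 \<le> (\<Sum>k<8. (- 1 / 2) ^ k / fact k * (3 ^ k / (2 * real k + 1 :: real)))"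
      by (simp add: eval_nat_numeral fact_numeral)
    from mult_left_mono[OF this s(2)] le show ?thesis by linarith
  qed
  have hi: "E \<le> sqrt 3 * 0.6634"
  proof -
    have "E \<le> (\<Sum>k<9. (- 1 / 2) ^ k / fact k * (sqrt 3 * 3 ^ k / (2 * real k + 1)))"
      unfolding E_def using has_integral_exp_series[OF s(2), of 9] exp_minus_alternating(2) s(1)
      by (intro has_integral_le[OF integrable_integral[OF int]]) auto
    moreover have "(\<Sum>k<9. (- 1 / 2) ^ k / fact k * (sqrt 3 * 3 ^ k / (2 * real k + 1))) = sqrt 3 * (\<Sum>k<9. (- 1 / 2) ^ k / fact k * (3 ^ k / (2 * real k + 1)))"
      by (simp add: sum_distrib_left mult_ac)
    ultimately have le: "E \<le> sqrt 3 * (\<Sum>k<9. (- 1 / 2) ^ k / fact k * (3 ^ k / (2 * real k + 1)))"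
      by simp
    have "(\<Sum>k<9. (- 1 / 2) ^ k / fact k * (3 ^ k / (2 * real k + 1 :: real))) \<le> 0.6634"
      by (simp add: eval_nat_numeral fact_numeral)
    from mult_left_mono[OF this s(2)] le show ?thesis by linarith
  qed
  have "integral {0..sqrt 3} std_normal_density = E / sqrt (2 * pi)"
    unfolding E_def normal_density_def by (simp flip: integral_mult_right)
  then have cdf: "std_normal_cdf (sqrt 3) = 1 / 2 + E / sqrt (2 * pi)"
    using std_normal_cdf_eq_integral[OF s(2)] by simp
  have c: "0.6909 \<le> sqrt 3 / sqrt (2 * pi)" "sqrt 3 / sqrt (2 * pi) \<le> 0.6911"
  proof -
    have eq: "sqrt 3 / sqrt (2 * pi) = sqrt (3 / (2 * pi))" by (simp add: real_sqrt_divide)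
    have "0.6909\<^sup>2 \<le> 3 / (2 * pi)" "3 / (2 * pi) \<le> 0.6911\<^sup>2"
      using pi_approx by (simp_all add: field_simps power2_eq_square)
    then show "0.6909 \<le> sqrt 3 / sqrt (2 * pi)" "sqrt 3 / sqrt (2 * pi) \<le> 0.6911"
      unfolding eq by (intro real_le_rsqrt real_le_lsqrt; simp)+
  qed
  have "E / sqrt (2 * pi) \<le> sqrt 3 / sqrt (2 * pi) * 0.6634"
    using divide_right_mono[OF hi, of "sqrt (2 * pi)"] by simp
  also have "\<dots> \<le> 0.6911 * 0.6634" using c by (intro mult_right_mono) auto
  finally have 1: "E / sqrt (2 * pi) \<le> 0.6911 * 0.6634" .
  have "0.6909 * 0.6633 \<le> sqrt 3 / sqrt (2 * pi) * 0.6633" using c by (intro mult_right_mono) auto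
  also have "\<dots> \<le> E / sqrt (2 * pi)" using divide_right_mono[OF lo, of "sqrt (2 * pi)"] by simp
  finally have 2: "0.6909 * 0.6633 \<le> E / sqrt (2 * pi)" .
  have "\<bar>1 / 2 + w - 0.958\<bar> < 0.0005" if "w \<le> 0.6911 * 0.6634" "0.6909 * 0.6633 \<le> w" for w :: real
    using that by (auto simp: abs_if)
  from this[OF 1 2] show ?thesis unfolding cdf .
qed

section \<open>Comparison with the normal distribution\<close>

context balanced_scales
begin

lemma Max_b: "0 \<le> Max (b ` I)" "Max (b ` I) < 1"
proof -
  have "I \<noteq> {}" using balanced by auto
  then have "Max (b ` I) \<in> b ` I" using fin by (intro Max_in) auto
  then show "0 \<le> Max (b ` I)" "Max (b ` I) < 1" using b_bounds by auto
qed

lemma G_eq_exp_logG: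
  assumes A3: "A \<ge> 3" and u: "u \<ge> 0"
  shows "G u = exp (logG I b 0 A (Max (b ` I)) u)"
proof -
  let ?\<tau> = "Max (b ` I)"
  interpret capped_weights I b 0 A by unfold_locales (use fin A3 b_bounds in auto)
  have "cap ?\<tau>"
    using fin Max_b by (auto simp: cap_def slack_def sum_b)
  then have w: "wsum I b 0 A ?\<tau> u / A > 0" using wsum_pos u A by simp
  have pos: "1 + u * b i > 0" "1 - b i > 0" for i using u b_bounds[of i] by (auto simp: add_pos_nonneg)
  have "exp (\<Sum>i\<in>I. ln (1 + u * b i) - ln (1 - b i)) = (\<Prod>i\<in>I. (1 + u * b i) / (1 - b i))"
    using pos by (simp add: exp_sum[OF fin] exp_diff)
  moreover have "logG I b 0 A ?\<tau> u = (\<Sum>i\<in>I. ln (1 + u * b i) - ln (1 - b i)) + ln (wsum I b 0 A ?\<tau> u / A)"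
    by (simp add: logG_def slack_def sum_b)
  moreover have "wsum I b 0 A ?\<tau> u = (\<Sum>i\<in>I. b i * (1 - b i) / (1 + u * b i))"
    by (simp add: wsum_def slack_def sum_b)
  ultimately show ?thesis using w by (simp add: exp_add G_def)
qed

lemma cone_probability_le_normal:
  assumes A3: "A \<ge> 3"
  shows "emeasure (gauss_prod I) {z \<in> space (gauss_prod I). A * V2 z < (S z)\<^sup>2}
    \<le> emeasure std_normal_distribution {y. A < y\<^sup>2}"
proof -
  let ?\<tau> = "Max (b ` I)"
  let ?f = "\<lambda>v. 1 / ((1 + v\<^sup>2) * sqrt (G (v\<^sup>2)))"
  let ?h = "\<lambda>v::real. exp (- ((1 + v\<^sup>2) * A) / 2) / (1 + v\<^sup>2)"
  have f_eq: "?f v = exp (- logG I b 0 A ?\<tau> (v\<^sup>2) / 2) / (1 + v\<^sup>2)" for v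
  proof -
    have "sqrt (exp x) = exp (x / 2)" for x :: real
      by (rule real_sqrt_unique) (auto simp: power2_eq_square exp_add[symmetric])
    then show ?thesis using G_eq_exp_logG[OF A3, of "v\<^sup>2"] by (simp add: exp_minus divide_simps)
  qed
  interpret C: capped_weights I b 0 A by unfold_locales (use fin A3 b_bounds in auto)
  have \<tau>: "0 \<le> ?\<tau>" "?\<tau> < 1" "\<And>i. i \<in> I \<Longrightarrow> b i \<le> ?\<tau>"
    using fin Max_b by auto
  have cap: "C.cap ?\<tau>" using \<tau> by (auto simp: C.cap_def slack_def sum_b)
  have cf: "continuous_on {0..N} ?f" for N
  proof -
    have "continuous_on {0..N} ((\<lambda>(\<tau>, v). exp (- logG I b 0 A \<tau> (v\<^sup>2) / 2) / (1 + v\<^sup>2)) \<circ> Pair ?\<tau>)"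
      using cap by (intro continuous_on_compose continuous_intros
        continuous_on_subset[OF C.continuous_kernel(1)[of "{?\<tau>}" "{0..N}"]]) auto
    then show ?thesis unfolding f_eq by (simp add: comp_def)
  qed
  have nz: "1 + v\<^sup>2 \<noteq> 0" for v :: real
    using add_pos_nonneg[OF zero_less_one, of "v\<^sup>2"] by simp
  have ch: "continuous_on X ?h" for X
    by (intro continuous_intros) (use nz in auto)
  have fm: "?f \<in> borel_measurable borel" unfolding G_def by measurable
  have fnn: "?f v \<ge> 0" for v unfolding f_eq by simp
  have trunc: "(\<integral>\<^sup>+v. ennreal (?f v) * indicator {0..real n} v \<partial>lborel) \<le> (\<integral>\<^sup>+v. ennreal (?h v) * indicator {0..} v \<partial>lborel)" for n
  proof -
    have "(\<integral>\<^sup>+v. ennreal (?f v) * indicator {0..real n} v \<partial>lborel) = ennreal (integral {0..real n} ?f)"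
      using fnn by (intro nn_integral_interval_eq_integral cf)
    also have "\<dots> \<le> ennreal (integral {0..real n} ?h)"
      unfolding f_eq using \<tau> A3 fin b_bounds
      by (intro ennreal_leI capped_integral_le) (auto simp: slack_def sum_b)
    also have "\<dots> = (\<integral>\<^sup>+v. ennreal (?h v) * indicator {0..real n} v \<partial>lborel)"
      by (intro nn_integral_interval_eq_integral[symmetric] ch) auto
    also have "\<dots> \<le> (\<integral>\<^sup>+v. ennreal (?h v) * indicator {0..} v \<partial>lborel)"
      by (intro nn_integral_mono) (auto simp: indicator_def)
    finally show ?thesis .
  qed
  have lim: "(\<integral>\<^sup>+v. ennreal (?f v) * indicator {0..} v \<partial>lborel) \<le> (\<integral>\<^sup>+v. ennreal (?h v) * indicator {0..} v \<partial>lborel)"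
  proof -
    have "(\<integral>\<^sup>+v. ennreal (?f v) * indicator {0..} v \<partial>lborel) = emeasure (density lborel ?f) {0..}"
      using fm by (simp add: emeasure_density)
    also have "\<dots> = emeasure (density lborel ?f) (\<Union>n. {0..real n})"
      by (rule arg_cong[where f = "emeasure _"]) (auto intro: real_arch_simple)
    also have "\<dots> = (SUP n. emeasure (density lborel ?f) {0..real n})"
      by (intro SUP_emeasure_incseq[symmetric]) (auto simp: incseq_def)
    also have "\<dots> \<le> (\<integral>\<^sup>+v. ennreal (?h v) * indicator {0..} v \<partial>lborel)"
      using trunc fm by (intro SUP_least) (simp add: emeasure_density)
    finally show ?thesis .
  qed
  have scale: "(\<integral>\<^sup>+v. ennreal (2 / pi * g v) * indicator {0..} v \<partial>lborel) = ennreal (2 / pi) * (\<integral>\<^sup>+v. ennreal (g v) * indicator {0..} v \<partial>lborel)"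
    if "g \<in> borel_measurable borel" for g :: "real \<Rightarrow> real"
  proof -
    have eq: "ennreal (2 / pi * g v) = ennreal (2 / pi) * ennreal (g v)" for v
      by (rule ennreal_mult') simp
    show ?thesis unfolding eq mult.assoc using that by (intro nn_integral_cmult) auto
  qed
  have "emeasure (gauss_prod I) {z \<in> space (gauss_prod I). A * V2 z < (S z)\<^sup>2}
      = (\<integral>\<^sup>+v. ennreal (2 / pi * ?f v) * indicator {0..} v \<partial>lborel)"
    unfolding cone_probability by simp
  also have "\<dots> \<le> (\<integral>\<^sup>+v. ennreal (2 / pi * ?h v) * indicator {0..} v \<partial>lborel)"
    unfolding scale[OF fm] using lim by (subst scale) (auto intro: mult_left_mono)
  also have "\<dots> = emeasure std_normal_distribution {y. A < y\<^sup>2}"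
    using A by (subst craig_formula) (auto simp: mult.commute)
  finally show ?thesis .
qed

end

text \<open>All weights equal \<open>A / n\<close>, and \<open>(1 + u * A / n) ^ n \<le> exp (u * A)\<close> bounds \<open>G\<close> from above. The loss is the factor
\<open>sqrt ((1 - A / n) ^ n) * exp (A / 2)\<close>, which tends to 1.\<close>
lemma cone_probability_all_equal:
  fixes n :: nat and A :: real
  assumes An: "A > 0" "A < real n"
  shows "ennreal (sqrt ((1 - A / n) ^ n) * exp (A / 2)) * emeasure std_normal_distribution {y. A < y\<^sup>2}
    \<le> emeasure (gauss_prod {1..n}) {z \<in> space (gauss_prod {1..n}). A * (\<Sum>i=1..n. (z i)\<^sup>2) < (\<Sum>i=1..n. z i)\<^sup>2}"
proof -
  define s where "s = 1 / sqrt (real n - A)"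
  have s: "s > 0" "s\<^sup>2 = 1 / (real n - A)" using An by (auto simp: s_def power_divide)
  have n: "real n > 0" using An by simp
  interpret balanced_scales "{1..n}" "\<lambda>_. s" A
    by unfold_locales (use An in \<open>auto simp: s field_simps\<close>)
  have b: "b i = A / n" for i
  proof -
    have "real n - A > 0" using An by simp
    then have "1 + A * s\<^sup>2 = n / (real n - A)" by (simp add: s field_simps)
    moreover have "A * s\<^sup>2 = A / (real n - A)" by (simp add: s)
    ultimately show ?thesis unfolding b_def using An by simp
  qed
  define d where "d = (1 - A / n) ^ n"
  have bn: "A / n < 1" "A / n > 0" using An by auto
  have d: "d > 0" using bn by (simp add: d_def)
  have G_le: "G u \<le> exp (u * A) / d" and G_pos: "G u > 0" if u: "u \<ge> 0" for u
  proof -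
    have p: "1 + u * (A / n) > 0"
      by (rule add_pos_nonneg[OF zero_less_one mult_nonneg_nonneg[OF u less_imp_le[OF bn(2)]]])
    have G_eq: "G u = (1 + u * (A / n)) ^ n / d * ((1 - A / n) / (1 + u * (A / n)))"
      unfolding G_def b d_def using An n by (simp add: power_divide)
    show "G u > 0" unfolding G_eq using p d bn by simp
    have "(1 - A / n) \<le> 1 * (1 + u * (A / n))"
      using bn u mult_nonneg_nonneg[of u "A / n"] by simp
    then have "(1 - A / n) / (1 + u * (A / n)) \<le> 1" using p by (simp add: divide_le_eq)
    then have "G u \<le> (1 + u * (A / n)) ^ n / d * 1"
      unfolding G_eq using p d by (intro mult_left_mono) auto
    also have "(1 + u * (A / n)) ^ n \<le> exp (u * (A / n)) ^ n"
      using p by (intro power_mono exp_ge_add_one_self) auto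
    also have "exp (u * (A / n)) ^ n = exp (u * A)"
      using n by (simp add: exp_of_nat_mult[symmetric])
    finally show "G u \<le> exp (u * A) / d" using d by (simp add: divide_right_mono)
  qed
  have cone: "{z \<in> space (gauss_prod {1..n}). A * (\<Sum>i=1..n. (z i)\<^sup>2) < (\<Sum>i=1..n. z i)\<^sup>2}
     = {z \<in> space (gauss_prod {1..n}). A * V2 z < (S z)\<^sup>2}"
  proof -
    have V: "A * V2 z = s\<^sup>2 * (A * (\<Sum>i=1..n. (z i)\<^sup>2))" for z unfolding V2_def by (simp add: sum_distrib_left mult_ac)
    have S: "(S z)\<^sup>2 = s\<^sup>2 * (\<Sum>i=1..n. z i)\<^sup>2" for z
      unfolding S_def by (simp add: sum_distrib_left[symmetric] power_mult_distrib)
    have "s\<^sup>2 > 0" using s(1) by simp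
    from mult_less_cancel_left_pos[OF this] show ?thesis unfolding V S by simp
  qed
  have "ennreal (sqrt d * exp (A / 2)) * emeasure std_normal_distribution {y. A < y\<^sup>2}
    = (\<integral>\<^sup>+v. ennreal (sqrt d * exp (A / 2)) * (ennreal (2 / pi * exp (- (A * (1 + v\<^sup>2) / 2)) / (1 + v\<^sup>2)) * indicator {0..} v) \<partial>lborel)"
    using A by (subst craig_formula) (auto simp: nn_integral_cmult)
  also have "\<dots> \<le> (\<integral>\<^sup>+v. ennreal (2 / pi / ((1 + v\<^sup>2) * sqrt (G (v\<^sup>2)))) * indicator {0..} v \<partial>lborel)"
  proof (intro nn_integral_mono)
    fix v :: real
    have p: "1 + v\<^sup>2 > 0" by (simp add: add_pos_nonneg)
    have "sqrt (G (v\<^sup>2)) \<le> sqrt (exp (v\<^sup>2 * A) / d)" using G_le by simp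
    also have "\<dots> = exp (v\<^sup>2 * A / 2) / sqrt d"
    proof -
      have "sqrt (exp x) = exp (x / 2)" for x :: real
        by (rule real_sqrt_unique) (auto simp: power2_eq_square exp_add[symmetric])
      then show ?thesis by (simp add: real_sqrt_divide)
    qed
    finally have "2 / pi / ((1 + v\<^sup>2) * (exp (v\<^sup>2 * A / 2) / sqrt d)) \<le> 2 / pi / ((1 + v\<^sup>2) * sqrt (G (v\<^sup>2)))"
      using p d G_pos by (intro divide_left_mono mult_left_mono) auto
    moreover have "sqrt d * exp (A / 2) * (2 / pi * exp (- (A * (1 + v\<^sup>2) / 2)) / (1 + v\<^sup>2)) = 2 / pi / ((1 + v\<^sup>2) * (exp (v\<^sup>2 * A / 2) / sqrt d))"
    proof -
      have e: "exp (A / 2) * exp (- (A * (1 + v\<^sup>2) / 2)) = 1 / exp (v\<^sup>2 * A / 2)"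
        by (simp add: exp_add[symmetric] exp_minus[symmetric] inverse_eq_divide[symmetric] algebra_simps add_divide_distrib)
      have "r * x * (k * y / w) = k / (w * (X / r))" if "x * y = 1 / X" for r x k y w X :: real
      proof -
        have "r * x * (k * y / w) = r * k * (x * y) / w" by simp
        then show ?thesis by (simp add: that mult_ac)
      qed
      from this[OF e] show ?thesis .
    qed
    ultimately have "ennreal (sqrt d * exp (A / 2)) * ennreal (2 / pi * exp (- (A * (1 + v\<^sup>2) / 2)) / (1 + v\<^sup>2)) \<le> ennreal (2 / pi / ((1 + v\<^sup>2) * sqrt (G (v\<^sup>2))))"
      using d by (subst ennreal_mult'[symmetric]) (auto intro: ennreal_leI)
    then show "ennreal (sqrt d * exp (A / 2)) * (ennreal (2 / pi * exp (- (A * (1 + v\<^sup>2) / 2)) / (1 + v\<^sup>2)) * indicator {0..} v)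
      \<le> ennreal (2 / pi / ((1 + v\<^sup>2) * sqrt (G (v\<^sup>2)))) * indicator {0..} v"
      by (simp add: indicator_def)
  qed
  also have "\<dots> = emeasure (gauss_prod {1..n}) {z \<in> space (gauss_prod {1..n}). A * V2 z < (S z)\<^sup>2}"
    by (rule cone_probability[symmetric])
  finally show ?thesis unfolding cone d_def .
qed

text \<open>As \<open>r\<close> grows, each nonzero scale contributes a term that tends to \<open>1 / A\<close> to the sum defining the normalisation. So the value 1 is
reached when there are more than \<open>A\<close> of them. With at most \<open>A\<close> nonzero scales the event is empty, by the
Cauchy-Schwarz inequality (\<open>few_scales_bound\<close>).\<close>
lemma exists_balanced_scales:
  fixes \<sigma> :: "'i \<Rightarrow> real"
  assumes I: "finite I" and A: "A > 0" and many: "A < real (card {i\<in>I. \<sigma> i \<noteq> 0})"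
  shows "\<exists>r>0. balanced_scales I (\<lambda>i. r * \<sigma> i) A"
proof -
  define J where "J = {i\<in>I. \<sigma> i \<noteq> 0}"
  define f where "f r = (\<Sum>i\<in>I. (r * \<sigma> i)\<^sup>2 / (1 + A * (r * \<sigma> i)\<^sup>2))" for r
  have nz: "1 + A * y\<^sup>2 \<noteq> 0" for y using A add_pos_nonneg[of 1 "A * y\<^sup>2"] by simp
  have cont: "continuous_on X f" for X
    unfolding f_def by (intro continuous_intros) (use nz in auto)
  have fJ: "f r = (\<Sum>i\<in>J. (r * \<sigma> i)\<^sup>2 / (1 + A * (r * \<sigma> i)\<^sup>2))" for r
    unfolding f_def using I by (intro sum.mono_neutral_right) (auto simp: J_def)
  have "((\<lambda>r. (r * y)\<^sup>2 / (1 + A * (r * y)\<^sup>2)) \<longlongrightarrow> 1 / A) at_top" if "y \<noteq> 0" for y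
  proof -
    define w where "w = y\<^sup>2"
    have w: "w > 0" using that by (simp add: w_def)
    then have "((\<lambda>r. r\<^sup>2 * w / (1 + A * (r\<^sup>2 * w))) \<longlongrightarrow> w * (inverse A * inverse w)) at_top"
      using A by real_asymp
    also have "w * (inverse A * inverse w) = 1 / A" using w by (simp add: field_simps)
    finally show ?thesis by (simp add: w_def power_mult_distrib)
  qed
  then have "(f \<longlongrightarrow> (\<Sum>i\<in>J. 1 / A)) at_top"
    unfolding fJ by (intro tendsto_sum) (auto simp: J_def)
  moreover have "1 < (\<Sum>i\<in>J. 1 / A)" using many A by (simp add: J_def)
  ultimately have "eventually (\<lambda>r. 1 < f r) at_top" by (rule order_tendstoD(1))
  then have "eventually (\<lambda>r. 1 < f r \<and> r \<ge> 0) at_top"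
    using eventually_ge_at_top[of 0] by eventually_elim auto
  then obtain R where R: "1 < f R" "R \<ge> 0"
    by (metis (no_types, lifting) eventually_at_top_linorder order_refl)
  have "f 0 \<le> 1" by (simp add: f_def)
  with R obtain r where r: "0 \<le> r" "f r = 1"
    using IVT'[of f 0 1 R] cont by auto
  then have "r \<noteq> 0" by (auto simp: f_def)
  then have "r > 0" using r(1) by simp
  moreover have "balanced_scales I (\<lambda>i. r * \<sigma> i) A"
    using r I A by (simp add: balanced_scales_def f_def)
  ultimately show ?thesis by blast
qed

lemma few_scales_bound:
  fixes \<sigma> z :: "'i \<Rightarrow> real"
  assumes I: "finite I" and few: "real (card {i\<in>I. \<sigma> i \<noteq> 0}) \<le> A"
  shows "(\<Sum>i\<in>I. \<sigma> i * z i)\<^sup>2 \<le> A * (\<Sum>i\<in>I. (\<sigma> i)\<^sup>2 * (z i)\<^sup>2)"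
proof -
  let ?J = "{i\<in>I. \<sigma> i \<noteq> 0}"
  have "(\<Sum>i\<in>I. \<sigma> i * z i)\<^sup>2 = (\<Sum>i\<in>?J. \<sigma> i * z i)\<^sup>2"
    using I by (subst sum.mono_neutral_right[of I ?J]) auto
  also have "\<dots> \<le> (\<Sum>i\<in>?J. (\<sigma> i * z i)\<^sup>2) * real (card ?J)"
    by (rule sum_squared_le_sum_of_squares)
  also have "\<dots> \<le> (\<Sum>i\<in>I. (\<sigma> i)\<^sup>2 * (z i)\<^sup>2) * A"
    using I few by (intro mult_mono sum_nonneg)
      (auto simp: power_mult_distrib intro!: sum_mono2)
  finally show ?thesis by (simp add: mult.commute)
qed

lemma cone_probability_cases:
  fixes \<sigma> :: "'i \<Rightarrow> real"
  assumes I: "finite I" and A: "A > 0"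
    and bound: "\<And>\<rho>. balanced_scales I \<rho> A \<Longrightarrow>
      emeasure (gauss_prod I) {z \<in> space (gauss_prod I). A * (\<Sum>i\<in>I. (\<rho> i)\<^sup>2 * (z i)\<^sup>2) < (\<Sum>i\<in>I. \<rho> i * z i)\<^sup>2} \<le> B"
  shows "emeasure (gauss_prod I) {z \<in> space (gauss_prod I). A * (\<Sum>i\<in>I. (\<sigma> i)\<^sup>2 * (z i)\<^sup>2) < (\<Sum>i\<in>I. \<sigma> i * z i)\<^sup>2} \<le> B"
proof (cases "real (card {i\<in>I. \<sigma> i \<noteq> 0}) \<le> A")
  case True
  have "{z \<in> space (gauss_prod I). A * (\<Sum>i\<in>I. (\<sigma> i)\<^sup>2 * (z i)\<^sup>2) < (\<Sum>i\<in>I. \<sigma> i * z i)\<^sup>2} = {}"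
    using few_scales_bound[OF I True] by (auto simp: not_less)
  then show ?thesis by (simp only: emeasure_empty zero_le)
next
  case False
  then obtain r where r: "r > 0" "balanced_scales I (\<lambda>i. r * \<sigma> i) A"
    using exists_balanced_scales[OF I A, of \<sigma>] by auto
  have eq: "A * (\<Sum>i\<in>I. (r * \<sigma> i)\<^sup>2 * (z i)\<^sup>2) = r\<^sup>2 * (A * (\<Sum>i\<in>I. (\<sigma> i)\<^sup>2 * (z i)\<^sup>2))"
    "(\<Sum>i\<in>I. r * \<sigma> i * z i)\<^sup>2 = r\<^sup>2 * (\<Sum>i\<in>I. \<sigma> i * z i)\<^sup>2" for z
    by (simp_all add: power_mult_distrib sum_distrib_left mult_ac flip: power_mult_distrib)
  have "r\<^sup>2 > 0" using r(1) by simp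
  from mult_less_cancel_left_pos[OF this] show ?thesis
    using bound[OF r(2)] unfolding eq by simp
qed

section \<open>The worst case over the scales and its limit\<close>

text \<open>If the denominator vanishes, then so does the numerator, and with the convention \<open>0 / 0 = 0\<close> both
sides are false.\<close>
lemma self_norm_sq_gt_iff:
  assumes "A \<ge> 0"
  shows "self_norm_sq n \<sigma> z > A \<longleftrightarrow> A * (\<Sum>i=1..n. (\<sigma> i)\<^sup>2 * (z i)\<^sup>2) < (\<Sum>i=1..n. \<sigma> i * z i)\<^sup>2"
proof -
  let ?V = "\<Sum>i=1..n. (\<sigma> i)\<^sup>2 * (z i)\<^sup>2"
  have "?V \<ge> 0" by (intro sum_nonneg) auto
  show ?thesis
  proof (cases "?V = 0")
    case True
    then have "\<forall>i\<in>{1..n}. (\<sigma> i)\<^sup>2 * (z i)\<^sup>2 = 0"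
      by (subst (asm) sum_nonneg_eq_0_iff) auto
    then have "(\<Sum>i=1..n. \<sigma> i * z i) = 0" by (intro sum.neutral) auto
    then show ?thesis using True assms by (simp add: self_norm_sq_def)
  next
    case False
    with \<open>?V \<ge> 0\<close> have "?V > 0" by simp
    then show ?thesis by (simp add: self_norm_sq_def pos_less_divide_eq)
  qed
qed

locale gaussian_sample = prob_space M for M :: "'a measure" +
  fixes Z :: "nat \<Rightarrow> 'a \<Rightarrow> real"
  assumes indep: "indep_vars (\<lambda>_. borel) Z {1..}"
    and normal: "\<And>i. i \<ge> 1 \<Longrightarrow> distributed M lborel (Z i) std_normal_density"
begin

definition tail :: "nat \<Rightarrow> (nat \<Rightarrow> real) \<Rightarrow> real \<Rightarrow> real" where
  "tail n \<sigma> A = measure M {\<omega> \<in> space M. self_norm_sq n \<sigma> (\<lambda>i. Z i \<omega>) > A}"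

definition worst :: "nat \<Rightarrow> real \<Rightarrow> real" where
  "worst n A = (SUP \<sigma>\<in>admissible_scales n. tail n \<sigma> A)"

lemma tG_eq: "tG M Z m x = 1 - 1/2 * worst (m + 1) (x\<^sup>2)"
  by (simp add: tG_def worst_def tail_def)

lemma Z_measurable: "i \<ge> 1 \<Longrightarrow> Z i \<in> borel_measurable M"
  using distributed_measurable[OF normal[of i]] by simp

lemma distr_Z: "i \<ge> 1 \<Longrightarrow> distr M borel (Z i) = std_normal_distribution"
proof -
  assume "i \<ge> 1"
  have "distr M borel (Z i) = distr M lborel (Z i)" by (intro distr_cong) auto
  then show ?thesis using normal[OF \<open>i \<ge> 1\<close>] by (simp add: distributed_def)
qed

lemma joint_law:
  assumes "n \<ge> 1"
  shows "distr M (PiM {1..n} (\<lambda>_. borel)) (\<lambda>\<omega>. \<lambda>i\<in>{1..n}. Z i \<omega>) = gauss_prod {1..n}"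
proof -
  have "indep_vars (\<lambda>_. borel) Z {1..n}" by (rule indep_vars_subset[OF indep]) auto
  then have "distr M (PiM {1..n} (\<lambda>_. borel)) (\<lambda>\<omega>. \<lambda>i\<in>{1..n}. Z i \<omega>) = PiM {1..n} (\<lambda>i. distr M borel (Z i))"
    using assms Z_measurable by (subst (asm) indep_vars_iff_distr_eq_PiM') auto
  also have "\<dots> = gauss_prod {1..n}" by (intro PiM_cong) (auto simp: distr_Z)
  finally show ?thesis .
qed

lemma tail_eq_cone:
  assumes n: "n \<ge> 1" and A: "A \<ge> 0"
  shows "ennreal (tail n \<sigma> A) = emeasure (gauss_prod {1..n})
    {z \<in> space (gauss_prod {1..n}). A * (\<Sum>i=1..n. (\<sigma> i)\<^sup>2 * (z i)\<^sup>2) < (\<Sum>i=1..n. \<sigma> i * z i)\<^sup>2}"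
proof -
  let ?P = "PiM {1..n} (\<lambda>_. borel :: real measure)"
  let ?X = "\<lambda>\<omega>. \<lambda>i\<in>{1..n}. Z i \<omega>"
  let ?C = "{z \<in> space ?P. A * (\<Sum>i=1..n. (\<sigma> i)\<^sup>2 * (z i)\<^sup>2) < (\<Sum>i=1..n. \<sigma> i * z i)\<^sup>2}"
  have X: "?X \<in> M \<rightarrow>\<^sub>M ?P" by (rule measurable_restrict) (auto intro: Z_measurable)
  have C: "?C \<in> sets ?P" by measurable
  have "ennreal (tail n \<sigma> A) = emeasure M (?X -` ?C \<inter> space M)"
  proof -
    have "{\<omega> \<in> space M. self_norm_sq n \<sigma> (\<lambda>i. Z i \<omega>) > A} = ?X -` ?C \<inter> space M"
      by (auto simp: self_norm_sq_gt_iff[OF A] space_PiM)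
    then show ?thesis by (simp add: tail_def emeasure_eq_measure)
  qed
  also have "\<dots> = emeasure (distr M ?P ?X) ?C" using X C by (simp add: emeasure_distr)
  also have "\<dots> = emeasure (gauss_prod {1..n}) ?C" by (simp only: joint_law[OF n])
  finally show ?thesis by (simp add: space_PiM)
qed

lemma tail_bounds: "0 \<le> tail n \<sigma> A" "tail n \<sigma> A \<le> 1"
  by (auto simp: tail_def)

lemma bdd_above_tail: "bdd_above ((\<lambda>\<sigma>. tail n \<sigma> A) ` S)"
  using tail_bounds by (auto intro!: bdd_aboveI[of _ 1])

lemma admissible_ones: "n \<ge> 1 \<Longrightarrow> (\<lambda>_. 1) \<in> admissible_scales n"
  by (auto simp: admissible_scales_def)

lemma tail_le_worst: "\<sigma> \<in> admissible_scales n \<Longrightarrow> tail n \<sigma> A \<le> worst n A"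
  unfolding worst_def by (intro cSUP_upper bdd_above_tail)

lemma worst_le:
  assumes "n \<ge> 1" "\<And>\<sigma>. \<sigma> \<in> admissible_scales n \<Longrightarrow> tail n \<sigma> A \<le> B"
  shows "worst n A \<le> B"
  unfolding worst_def using assms admissible_ones by (intro cSUP_least) auto

text \<open>Scales for \<open>n\<close> variables are scales for \<open>n + 1\<close> variables, with a zero appended.\<close>
lemma worst_mono: "n \<ge> 1 \<Longrightarrow> worst n A \<le> worst (Suc n) A"
proof (rule worst_le)
  fix \<sigma> assume s: "\<sigma> \<in> admissible_scales n"
  let ?\<sigma> = "\<lambda>i. if i \<le> n then \<sigma> i else 0"
  have "tail n \<sigma> A = tail (Suc n) ?\<sigma> A"
    by (simp add: tail_def self_norm_sq_def)
  also have "\<dots> \<le> worst (Suc n) A"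
    using s by (intro tail_le_worst) (auto simp: admissible_scales_def)
  finally show "tail n \<sigma> A \<le> worst (Suc n) A" .
qed simp

lemma tG_convergent: "convergent (\<lambda>m. tG M Z m x)"
proof -
  have dec: "decseq (\<lambda>m. tG M Z m x)"
    unfolding tG_eq by (rule decseq_SucI) (simp add: worst_mono)
  have lb: "1 / 2 \<le> tG M Z m x" for m
  proof -
    have "worst (m + 1) (x\<^sup>2) \<le> 1" by (intro worst_le tail_bounds) auto
    then show ?thesis by (simp add: tG_eq)
  qed
  obtain L where "(\<lambda>m. tG M Z m x) \<longlonglongrightarrow> L"
    using decseq_convergent[OF dec] lb by blast
  then show ?thesis by (rule convergentI)
qed

lemma PhiG_eqI:
  assumes "(\<lambda>n. worst (n + 1) (x\<^sup>2)) \<longlonglongrightarrow> w"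
  shows "PhiG M Z x = 1 - 1/2 * w"
  unfolding PhiG_def tG_eq by (intro limI tendsto_intros assms)

text \<open>With a single nonzero scale the statistic is almost surely 1.\<close>
lemma PhiG_less_one:
  assumes "0 \<le> x" "x < 1"
  shows "PhiG M Z x = 0.5"
proof -
  have x2: "x\<^sup>2 < 1" using assms by (simp add: power_less_one_iff)
  have "worst (n + 1) (x\<^sup>2) = 1" for n
  proof (rule antisym)
    show "worst (n + 1) (x\<^sup>2) \<le> 1" by (intro worst_le tail_bounds) auto
    let ?\<sigma> = "\<lambda>i::nat. if i = 1 then 1 else (0::real)"
    have s: "self_norm_sq (n + 1) ?\<sigma> z = (z 1)\<^sup>2 / (z 1)\<^sup>2" for z
      by (simp add: self_norm_sq_def if_distrib[of "\<lambda>s. s * _"] if_distrib[of "\<lambda>s. s\<^sup>2"] cong: if_cong)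
    have "AE \<omega> in M. Z 1 \<omega> \<noteq> 0"
      using distributed_AE2[OF normal[of 1], of "\<lambda>y. y \<noteq> 0"] AE_lborel_singleton[of 0] by auto
    then have "AE \<omega> in M. (Z 1 \<omega>)\<^sup>2 / (Z 1 \<omega>)\<^sup>2 > x\<^sup>2"
      by eventually_elim (use x2 in simp)
    moreover have [measurable]: "Z 1 \<in> borel_measurable M" by (simp add: Z_measurable)
    ultimately have "tail (n + 1) ?\<sigma> (x\<^sup>2) = 1"
      unfolding tail_def s by (intro prob_Collect_eq_1[THEN iffD2]) measurable
    then show "1 \<le> worst (n + 1) (x\<^sup>2)"
      using tail_le_worst[of ?\<sigma> "n + 1" "x\<^sup>2"] by (simp add: admissible_scales_def)
  qed
  then have "PhiG M Z x = 1 - 1/2 * 1" by (intro PhiG_eqI) simp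
  then show ?thesis by simp
qed

lemma PhiG_one: "PhiG M Z 1 = 0.75"
proof -
  have half: "worst (n + 1) (1\<^sup>2) = 1 / 2" if "n \<ge> 1" for n
  proof (rule antisym)
    show "worst (n + 1) (1\<^sup>2) \<le> 1 / 2"
    proof (rule worst_le)
      fix \<sigma>
      have "ennreal (tail (n + 1) \<sigma> 1) \<le> ennreal (1 / 2)"
        unfolding tail_eq_cone[OF le_add2 zero_le_one]
      proof (rule cone_probability_cases)
        fix \<rho> :: "nat \<Rightarrow> real" assume "balanced_scales {1..n+1} \<rho> 1"
        then interpret balanced_scales "{1..n+1}" \<rho> 1 .
        show "emeasure (gauss_prod {1..n+1}) {z \<in> space (gauss_prod {1..n+1}).
          1 * (\<Sum>i=1..n+1. (\<rho> i)\<^sup>2 * (z i)\<^sup>2) < (\<Sum>i=1..n+1. \<rho> i * z i)\<^sup>2} \<le> ennreal (1 / 2)"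
          using cone_probability_le_half[OF refl] unfolding S_def V2_def .
      qed auto
      then have "tail (n + 1) \<sigma> 1 \<le> 1 / 2" by (subst (asm) ennreal_le_iff) simp_all
      then show "tail (n + 1) \<sigma> (1\<^sup>2) \<le> 1 / 2" by simp
    qed simp
    let ?\<sigma> = "\<lambda>i. if i = 1 \<or> i = 2 then 1 else (0::real)"
    have "ennreal (tail (n + 1) ?\<sigma> 1) = ennreal (1 / 2)"
      unfolding tail_eq_cone[OF le_add2 zero_le_one]
      using cone_probability_two_equal[of "{1..n+1}" 1 2] that by simp
    then have "tail (n + 1) ?\<sigma> 1 = 1 / 2" using tail_bounds by (subst (asm) ennreal_inj) auto
    moreover have "?\<sigma> \<in> admissible_scales (n + 1)"
      by (auto simp: admissible_scales_def intro!: bexI[of _ 1])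
    ultimately show "1 / 2 \<le> worst (n + 1) (1\<^sup>2)"
      using tail_le_worst[of ?\<sigma> "n + 1" 1] by simp
  qed
  have "eventually (\<lambda>n. worst (n + 1) (1\<^sup>2) = 1 / 2) sequentially"
    by (intro eventually_mono[OF eventually_ge_at_top[of 1]] half)
  then have "PhiG M Z 1 = 1 - 1/2 * (1 / 2)" by (intro PhiG_eqI tendsto_eventually)
  then show ?thesis by simp
qed

lemma PhiG_ge_sqrt3:
  assumes "x \<ge> sqrt 3"
  shows "PhiG M Z x = std_normal_cdf x"
proof -
  interpret N: real_distribution std_normal_distribution by (rule real_dist_normal_dist)
  define A where "A = x\<^sup>2"
  define T where "T = measure std_normal_distribution {y. A < y\<^sup>2}"
  have x0: "x \<ge> 0" using assms order.trans[of 0 "sqrt 3" x] by simp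
  have A3: "A \<ge> 3" unfolding A_def using power_mono[OF assms, of 2] by simp
  have A0: "A > 0" using A3 by simp
  have eT: "emeasure std_normal_distribution {y. A < y\<^sup>2} = ennreal T"
    by (simp add: T_def N.emeasure_eq_measure)
  have T0: "T \<ge> 0" by (simp add: T_def)
  have upper: "worst (n + 1) A \<le> T" for n
  proof (rule worst_le)
    fix \<sigma>
    have "ennreal (tail (n + 1) \<sigma> A) \<le> ennreal T"
      unfolding tail_eq_cone[OF le_add2 less_imp_le[OF A0]] eT[symmetric]
    proof (rule cone_probability_cases[OF _ A0])
      fix \<rho> :: "nat \<Rightarrow> real" assume "balanced_scales {1..n+1} \<rho> A"
      then interpret balanced_scales "{1..n+1}" \<rho> A .
      show "emeasure (gauss_prod {1..n+1}) {z \<in> space (gauss_prod {1..n+1}).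
        A * (\<Sum>i=1..n+1. (\<rho> i)\<^sup>2 * (z i)\<^sup>2) < (\<Sum>i=1..n+1. \<rho> i * z i)\<^sup>2} \<le> emeasure std_normal_distribution {y. A < y\<^sup>2}"
        using cone_probability_le_normal[OF A3] unfolding S_def V2_def .
    qed simp
    then show "tail (n + 1) \<sigma> A \<le> T" using T0 by simp
  qed simp
  have lower: "sqrt ((1 - A / real (n + 1)) ^ (n + 1)) * exp (A / 2) * T \<le> worst (n + 1) A" if n: "A < real (n + 1)" for n
  proof -
    let ?k = "sqrt ((1 - A / real (n + 1)) ^ (n + 1)) * exp (A / 2)"
    have k0: "?k \<ge> 0" using n A3 by simp
    have "ennreal (?k * T) \<le> ennreal (tail (n + 1) (\<lambda>_. 1) A)"
      unfolding tail_eq_cone[OF le_add2 less_imp_le[OF A0]] ennreal_mult'[OF k0]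
      using cone_probability_all_equal[OF A0 n] unfolding eT by (simp only: one_power2 mult_1)
    then have "?k * T \<le> tail (n + 1) (\<lambda>_. 1) A" using tail_bounds by (simp add: ennreal_le_iff)
    also have "\<dots> \<le> worst (n + 1) A" by (intro tail_le_worst admissible_ones) simp
    finally show ?thesis .
  qed
  have lim: "(\<lambda>n. sqrt ((1 - A / real (n + 1)) ^ (n + 1)) * exp (A / 2) * T) \<longlonglongrightarrow> T"
  proof -
    have "(\<lambda>n. (1 + (- A) / real n) ^ n) \<longlonglongrightarrow> exp (- A)"
      by (rule tendsto_exp_limit_sequentially)
    then have "(\<lambda>n. (1 - A / real (n + 1)) ^ (n + 1)) \<longlonglongrightarrow> exp (- A)"
      using LIMSEQ_ignore_initial_segment[of _ _ 1] by fastforce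
    then have "(\<lambda>n. sqrt ((1 - A / real (n + 1)) ^ (n + 1)) * exp (A / 2) * T) \<longlonglongrightarrow> sqrt (exp (- A)) * exp (A / 2) * T"
      by (intro tendsto_intros)
    moreover have "sqrt (exp (- A)) = exp (- A / 2)"
      by (rule real_sqrt_unique) (auto simp: power2_eq_square exp_add[symmetric])
    ultimately show ?thesis by (simp add: exp_add[symmetric])
  qed
  have "(\<lambda>n. worst (n + 1) A) \<longlonglongrightarrow> T"
  proof (rule tendsto_sandwich[OF _ _ lim tendsto_const])
    obtain n0 :: nat where "A < real n0" using reals_Archimedean2 by blast
    then have "A < real (n + 1)" if "n \<ge> n0" for n using that by simp
    then show "eventually (\<lambda>n. sqrt ((1 - A / real (n + 1)) ^ (n + 1)) * exp (A / 2) * T \<le> worst (n + 1) A) sequentially"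
      by (intro eventually_mono[OF eventually_ge_at_top[of n0]] lower)
  qed (use upper in auto)
  then have "PhiG M Z x = 1 - 1/2 * T" by (intro PhiG_eqI) (simp add: A_def)
  also have "T = 2 * (1 - std_normal_cdf x)"
    unfolding T_def A_def by (rule std_normal_cdf_two_sided[OF x0])
  finally show ?thesis by (simp add: field_simps)
qed

end

theorem corollary2:
  fixes M :: "'a measure" and Z :: "nat \<Rightarrow> 'a \<Rightarrow> real"
  assumes "prob_space M"
    and "prob_space.indep_vars M (\<lambda>_. borel) Z {1..}"
    and "\<And>i. i \<ge> 1 \<Longrightarrow> distributed M lborel (Z i) std_normal_density"
  shows "(\<forall>x\<ge>0. convergent (\<lambda>n. tG M Z n x))
    \<and> (\<forall>x. 0 \<le> x \<and> x < 1 \<longrightarrow> PhiG M Z x = 0.5)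
    \<and> PhiG M Z 1 = 0.75
    \<and> (\<forall>x\<ge>sqrt 3. PhiG M Z x = std_normal_cdf x)
    \<and> PhiG M Z (sqrt 3) = std_normal_cdf (sqrt 3)
    \<and> \<bar>std_normal_cdf (sqrt 3) - 0.958\<bar> < 0.0005"
proof -
  interpret gaussian_sample M Z
    using assms by (simp add: gaussian_sample_def gaussian_sample_axioms_def)
  show ?thesis
    using tG_convergent PhiG_less_one PhiG_one PhiG_ge_sqrt3 std_normal_cdf_sqrt3 by simp
qed

end
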